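(* Let $A\in\mathbb{R}^{m\times n}$, $\mathbf{b}\in\mathbb{R}^m$, and let $0=g_0\le g_1\le\dots\le g_n\le\infty$. Suppose that $\mathbf{x}$ is a stationary point of $\mathcal{R}_g(\mathbf{x})+\|A\mathbf{x}-\mathbf{b}\|^2$, that is, $2\mathbf{z}\in\partial f^{**}(\mathbf{x})$ with $\mathbf{z}=(I-A^TA)\mathbf{x}+A^T\mathbf{b}$, and that $\operatorname{card}(\mathbf{x})=k$, where $$(1-\delta_{2k})\|\mathbf{v}\|^2\le\|A\mathbf{v}\|^2\le(1+\delta_{2k})\|\mathbf{v}\|^2\quad\text{for all }\mathbf{v}\text{ with }\operatorname{card}(\mathbf{v})\le 2k.$$ Suppose further that $\tilde{x}_i\notin(0,\sqrt{g_i})$ for all $i$, and that $$\tilde{z}_i\notin\left[(1-\delta_{2k})\sqrt{g_k},\ \frac{\sqrt{g_k}}{1-\delta_{2k}}\right]\ \text{ for all } i,\qquad\text{and}\qquad\tilde{z}_{k+1}<(1-2\delta_{2k})\tilde{z}_k.$$ If $\|A\|<1$ and $g_i=\infty$ for all $i>k$, then $\mathbf{x}$ is the unique local minimizer of $\mathcal{R}_g(\mathbf{x})+\|A\mathbf{x}-\mathbf{b}\|^2$ and a global minimizer of $G(\operatorname{card}(\mathbf{x}))+\|A\mathbf{x}-\mathbf{b}\|^2$.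
   Context: $\|\cdot\|$ is the Euclidean norm for vectors and the operator (spectral) norm for matrices. $\operatorname{card}(\mathbf{x})$ is the number of nonzero entries of $\mathbf{x}$. For $\mathbf{x}\in\mathbb{R}^n$, $\tilde{\mathbf{x}}$ denotes the vector of absolute values of the entries of $\mathbf{x}$ sorted in non-increasing order, $\tilde{x}_1\ge\dots\ge\tilde{x}_n\ge0$ (similarly $\tilde{\mathbf{z}}$), with the conventions $\tilde z_0=\infty$, $\tilde z_{n+1}=0$. Given $0=g_0\le g_1\le\dots\le g_n\le\infty$ (the value $\infty$ is allowed for $i>0$, with $\sqrt{\infty}=\infty$), put $G(j)=\sum_{i=0}^j g_i$ and $f(\mathbf{x})=G(\operatorname{card}(\mathbf{x}))+\|\mathbf{x}\|^2$. Let $f^{**}$ be the convex envelope of $f$ (the largest convex function with $f^{**}\le f$), $\partial f^{**}$ its convex subdifferential, and $\mathcal{R}_g(\mathbf{x})=f^{**}(\mathbf{x})-\|\mathbf{x}\|^2$. *)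

theory Defs
  imports "HOL-Analysis.Analysis"
begin

definition nnz :: "real ^ 'n \<Rightarrow> nat" where
  "nnz x = card {i. x $ i \<noteq> 0}"

definition sorted_abs_list :: "real ^ 'n \<Rightarrow> real list" where
  "sorted_abs_list x =
     rev (sorted_list_of_multiset (image_mset (\<lambda>i. \<bar>x $ i\<bar>) (mset_set UNIV)))"

(* The entries are numbered from 1, with the boundary conventions
   infinity at index 0 and 0 at all indices beyond the dimension. *)
definition sorted_abs :: "real ^ 'n \<Rightarrow> nat \<Rightarrow> ereal" where
  "sorted_abs x i =
     (if i = 0 then \<infinity>
      else if i \<le> CARD('n) then ereal (sorted_abs_list x ! (i - 1))
      else 0)"

definition esqrt :: "ereal \<Rightarrow> ereal" where
  "esqrt a = (case a of ereal r \<Rightarrow> ereal (sqrt r) | PInfty \<Rightarrow> \<infinity> | MInfty \<Rightarrow> -\<infinity>)"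

definition G_g :: "(nat \<Rightarrow> ereal) \<Rightarrow> nat \<Rightarrow> ereal" where
  "G_g g j = (\<Sum>i\<le>j. g i)"

definition f_g :: "(nat \<Rightarrow> ereal) \<Rightarrow> real ^ 'n \<Rightarrow> ereal" where
  "f_g g x = G_g g (nnz x) + ereal ((norm x)\<^sup>2)"

(* Convexity of an extended-real-valued function, via its epigraph; this
   avoids evaluating infinity - infinity. *)
definition econvex :: "('a::real_vector \<Rightarrow> ereal) \<Rightarrow> bool" where
  "econvex h \<longleftrightarrow> convex {(x, r). h x \<le> ereal r}"

definition convex_envelope :: "('a::real_vector \<Rightarrow> ereal) \<Rightarrow> 'a \<Rightarrow> ereal" where
  "convex_envelope h x = (SUP u \<in> {u. econvex u \<and> u \<le> h}. u x)"

lemma convex_envelope_le: "convex_envelope h \<le> h"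
  by (auto simp: convex_envelope_def le_fun_def intro!: SUP_least)

lemma convex_envelope_greatest:
  "econvex u \<Longrightarrow> u \<le> h \<Longrightarrow> u \<le> convex_envelope h"
  by (auto simp: convex_envelope_def le_fun_def intro!: SUP_upper2[where i = u])

lemma econvex_convex_envelope: "econvex (convex_envelope h)"
proof -
  have "{(x, r). convex_envelope h x \<le> ereal r} =
      (\<Inter>u \<in> {u. econvex u \<and> u \<le> h}. {(x, r). u x \<le> ereal r})"
    by (auto simp: convex_envelope_def SUP_le_iff)
  moreover have "convex \<dots>"
    by (rule convex_INT) (auto simp: econvex_def)
  ultimately show ?thesis
    by (simp add: econvex_def)
qed

definition subdifferential :: "('a::real_inner \<Rightarrow> ereal) \<Rightarrow> 'a \<Rightarrow> 'a set" where
  "subdifferential h x = {v. \<forall>y. h x + ereal (v \<bullet> (y - x)) \<le> h y}"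

definition R_g :: "(nat \<Rightarrow> ereal) \<Rightarrow> real ^ 'n \<Rightarrow> ereal" where
  "R_g g x = convex_envelope (f_g g) x - ereal ((norm x)\<^sup>2)"

(* A minimizer must have a finite objective value: otherwise every interior
   point of the set where the objective is infinite would be a local minimizer. *)
definition local_minimizer :: "('a::metric_space \<Rightarrow> ereal) \<Rightarrow> 'a \<Rightarrow> bool" where
  "local_minimizer F x \<longleftrightarrow> \<bar>F x\<bar> \<noteq> \<infinity> \<and> (\<exists>e>0. \<forall>y\<in>ball x e. F x \<le> F y)"

definition global_minimizer :: "('a \<Rightarrow> ereal) \<Rightarrow> 'a \<Rightarrow> bool" where
  "global_minimizer F x \<longleftrightarrow> \<bar>F x\<bar> \<noteq> \<infinity> \<and> (\<forall>y. F x \<le> F y)"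

definition unique_local_minimizer :: "('a::metric_space \<Rightarrow> ereal) \<Rightarrow> 'a \<Rightarrow> bool" where
  "unique_local_minimizer F x \<longleftrightarrow>
     local_minimizer F x \<and> (\<forall>y. local_minimizer F y \<longrightarrow> y = x)"

end

theory Submission
  imports Defs
begin

text \<open>
  Write \<open>f u = G (card u) + (norm u)\<^sup>2\<close> and \<open>q u = (norm (A *v u - b))\<^sup>2 - (norm u)\<^sup>2\<close>.  The
  regularized objective is the convex envelope of \<open>f\<close> plus \<open>q\<close>, and \<open>q\<close> is strictly
  concave because \<open>A\<close> is a strict contraction.

  Stationary points can be located because \<open>f\<close> minus the linear function \<open>2 * (z \<bullet> u)\<close>
  is described by finitely many paraboloids of equal curvature, one for each possible support
  \<open>S\<close>, with vertex the restriction of \<open>z\<close> to \<open>S\<close> and height \<open>G (card S)\<close> minus the sum of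
  the squared entries of \<open>z\<close> on \<open>S\<close>.  If \<open>2 z\<close> is a subgradient of the envelope at \<open>y\<close>, then
  \<open>y\<close> lies in the convex hull of the lowest vertices
  (\<open>stationary_value_and_hull\<close>).  For the given \<open>x\<close> the gap
  conditions on \<open>x\<close> and \<open>z\<close> leave only one optimal support, namely the set \<open>S\<close> of the \<open>k\<close>
  largest entries of \<open>z\<close>; so \<open>x\<close> is \<open>z\<close> restricted to \<open>S\<close>.

  The quantitative gaps then give a growth estimate for \<open>f\<close>, and thus for its envelope,
  above the supporting affine function at \<open>x\<close> (\<open>quadratic_growth\<close>): a quadratic term with
  coefficient \<open>\<delta>\<close> and a linear term in the entries off \<open>S\<close>.  The restricted isometry
  property says that \<open>q\<close> falls below its tangent by at most \<open>\<delta> * (norm d)\<^sup>2\<close> along a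
  \<open>2 * k\<close>-sparse displacement \<open>d\<close>.  This proves at once that \<open>x\<close> is a global minimizer
  of the original objective, which is infinite off the \<open>k\<close>-sparse vectors.  For
  displacements that are not sparse the linear term helps out
  near \<open>x\<close>, so that \<open>x\<close> is a local minimizer of the regularized one.

  For uniqueness let \<open>y\<close> be a local minimizer, with \<open>w\<close> in the role of \<open>z\<close>.  Because \<open>q\<close> is
  strictly concave, \<open>y\<close> cannot be a proper convex combination of lowest vertices; so \<open>y\<close> is the
  restriction of \<open>w\<close> to an optimal support and is \<open>k\<close>-sparse.  Now \<open>(w - z) \<bullet> (y - x)\<close> equals
  \<open>(norm (y - x))\<^sup>2 - (norm (A *v (y - x)))\<^sup>2\<close>, which the restricted isometry bounds above by
  \<open>\<delta> * (norm (y - x))\<^sup>2\<close>; but it exceeds that number when \<open>y \<noteq> x\<close>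
  (\<open>optimal_supports_strongly_monotone\<close>).
\<close>

section \<open>Convex envelopes and their subgradients\<close>

lemma convex_minorant_le_envelope:
  assumes "convex_on UNIV \<phi>" and "\<And>u. ereal (\<phi> u) \<le> f u"
  shows "ereal (\<phi> u) \<le> convex_envelope f u"
proof -
  have "{(x, r). ereal (\<phi> x) \<le> ereal r} = epigraph UNIV \<phi>"
    by (auto simp: epigraph_def)
  then have "econvex (\<lambda>u. ereal (\<phi> u))"
    using assms(1) by (simp add: econvex_def convex_epigraph)
  then show ?thesis
    using convex_envelope_greatest[of "\<lambda>u. ereal (\<phi> u)" f] assms(2) by (auto simp: le_fun_def)
qed

lemma convex_on_affine: "convex_on UNIV (\<lambda>u. c + v \<bullet> u)"
  by (rule convex_onI) (simp_all add: inner_add_right algebra_simps)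

lemma econvexD:
  assumes "econvex h" "h u \<le> ereal a" "h v \<le> ereal b" "0 \<le> t" "t \<le> 1"
  shows "h (u + t *\<^sub>R (v - u)) \<le> ereal (a + t * (b - a))"
proof -
  have "(1 - t) *\<^sub>R (u, a) + t *\<^sub>R (v, b) \<in> {(x, r). h x \<le> ereal r}"
    using assms by (intro convexD) (auto simp: econvex_def)
  moreover have "(1 - t) *\<^sub>R (u, a) + t *\<^sub>R (v, b) = (u + t *\<^sub>R (v - u), a + t * (b - a))"
    by (simp add: algebra_simps)
  ultimately show ?thesis by simp
qed

text \<open>
  The reason that stationary points can be described explicitly.  Subtracting
  the linear function \<open>v\<close> from \<open>f\<close> leaves a function bounded below by finitely many
  paraboloids of equal curvature, with vertices \<open>p i\<close> and heights \<open>e i\<close>.  The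
  lowest height gives an affine minorant of \<open>f\<close>, which must touch the envelope at
  \<open>y\<close>.  If \<open>y\<close> were outside the hull of the lowest vertices, a hyperplane would
  separate it from them, and tilting that minorant slightly about the hyperplane would
  raise it at \<open>y\<close>.  It would still lie below \<open>f\<close>: near a lowest vertex the tilt
  lowers it to first order, against a loss of second order, and the other
  paraboloids leave a gap of fixed size.
\<close>

lemma stationary_value_and_hull:
  fixes f :: "'a::euclidean_space \<Rightarrow> ereal" and p :: "'i \<Rightarrow> 'a" and e :: "'i \<Rightarrow> real"
  assumes "finite I" "I \<noteq> {}"
    and stat: "v \<in> subdifferential (convex_envelope f) y"
    and lower: "\<And>u. f u = \<infinity> \<or> (\<exists>i\<in>I. ereal (e i + v \<bullet> u + (norm (u - p i))\<^sup>2) \<le> f u)"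
    and upper: "\<And>i. i \<in> I \<Longrightarrow> f (p i) \<le> ereal (e i + v \<bullet> p i)"
  shows "convex_envelope f y = ereal (Min (e ` I) + v \<bullet> y)"
    and "y \<in> convex hull (p ` {i\<in>I. e i = Min (e ` I)})"
proof -
  define m where "m = Min (e ` I)"
  have m_le: "m \<le> e i" if "i \<in> I" for i
    using that \<open>finite I\<close> by (simp add: m_def)
  obtain i0 where i0: "i0 \<in> I" "e i0 = m"
    using Min_in[of "e ` I"] \<open>finite I\<close> \<open>I \<noteq> {}\<close> by (metis finite_imageI image_iff image_is_empty m_def)
  have sub: "convex_envelope f y + ereal (v \<bullet> (u - y)) \<le> convex_envelope f u" for u
    using stat by (simp add: subdifferential_def)
  have env_p: "convex_envelope f (p i0) \<le> ereal (m + v \<bullet> p i0)"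
    using convex_envelope_le[of f] upper[OF i0(1)] i0(2)
    by (metis le_fun_def order_trans)
  have aff: "ereal (m + v \<bullet> u) \<le> f u" for u
  proof (cases "f u = \<infinity>")
    case False
    then obtain i where i: "i \<in> I" "ereal (e i + v \<bullet> u + (norm (u - p i))\<^sup>2) \<le> f u"
      using lower by blast
    have "m + v \<bullet> u \<le> e i + v \<bullet> u + (norm (u - p i))\<^sup>2"
      using m_le[OF i(1)] zero_le_power2[of "norm (u - p i)"] by linarith
    then show ?thesis
      using i(2) by (metis ereal_less_eq(3) order_trans)
  qed simp
  have lo: "ereal (m + v \<bullet> y) \<le> convex_envelope f y"
    by (rule convex_minorant_le_envelope[OF convex_on_affine aff])
  have hi: "convex_envelope f y \<le> ereal (m + v \<bullet> y)"
    using order_trans[OF sub env_p]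
    by (cases "convex_envelope f y") (auto simp: inner_diff_right)
  show val: "convex_envelope f y = ereal (Min (e ` I) + v \<bullet> y)"
    using lo hi by (simp add: m_def)
  let ?H = "convex hull (p ` {i\<in>I. e i = m})"
  have "y \<in> ?H"
  proof (rule ccontr)
    assume "y \<notin> ?H"
    moreover have "closed ?H"
      using \<open>finite I\<close> by (intro compact_imp_closed finite_imp_compact_convex_hull) auto
    ultimately obtain a b where ab: "a \<bullet> y < b" "\<And>u. u \<in> ?H \<Longrightarrow> b < a \<bullet> u"
      using separating_hyperplane_closed_point[of ?H y] convex_convex_hull by blast
    \<comment> \<open>Slope \<open>s\<close> of the tilt: completing the square, \<open>s\<^sup>2 * (norm a)\<^sup>2 / 4\<close> is what a paraboloid loses.\<close>
    have "\<forall>\<^sub>F s in at_right 0. s * (b - a \<bullet> p i) + s\<^sup>2 * (norm a)\<^sup>2 / 4 \<le> e i - m" if "i \<in> I" for i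
    proof (cases "e i = m")
      case True
      then have neg: "b - a \<bullet> p i < 0"
        using ab(2)[of "p i"] that by (simp add: hull_inc)
      have lim: "((\<lambda>s. (b - a \<bullet> p i) + s * (norm a)\<^sup>2 / 4) \<longlongrightarrow> (b - a \<bullet> p i) + 0 * (norm a)\<^sup>2 / 4) (at_right 0)"
        by (intro tendsto_intros) auto
      then have "\<forall>\<^sub>F s in at_right 0. (b - a \<bullet> p i) + s * (norm a)\<^sup>2 / 4 < 0"
        using neg by (intro order_tendstoD(2)[OF lim]) simp
      moreover have "\<forall>\<^sub>F s::real in at_right 0. 0 < s"
        by (simp add: eventually_at_right_less)
      ultimately show ?thesis
      proof eventually_elim
        case (elim s)
        have "s * ((b - a \<bullet> p i) + s * (norm a)\<^sup>2 / 4) \<le> 0"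
          using elim by (simp add: mult_nonneg_nonpos)
        then show ?case
          using True by (simp add: algebra_simps power2_eq_square)
      qed
    next
      case False
      then have pos: "0 < e i - m"
        using m_le[OF that] by simp
      have lim: "((\<lambda>s. s * (b - a \<bullet> p i) + s\<^sup>2 * (norm a)\<^sup>2 / 4) \<longlongrightarrow>
          0 * (b - a \<bullet> p i) + 0\<^sup>2 * (norm a)\<^sup>2 / 4) (at_right 0)"
        by (intro tendsto_intros) auto
      have "\<forall>\<^sub>F s in at_right 0. s * (b - a \<bullet> p i) + s\<^sup>2 * (norm a)\<^sup>2 / 4 < e i - m"
        using pos by (intro order_tendstoD(2)[OF lim]) simp
      then show ?thesis
        by eventually_elim simp
    qed
    then have "\<forall>\<^sub>F s in at_right 0. \<forall>i\<in>I. s * (b - a \<bullet> p i) + s\<^sup>2 * (norm a)\<^sup>2 / 4 \<le> e i - m"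
      using \<open>finite I\<close> by (simp add: eventually_ball_finite)
    moreover have "\<forall>\<^sub>F s::real in at_right 0. 0 < s"
      by (simp add: eventually_at_right_less)
    ultimately have "\<forall>\<^sub>F s in at_right 0. 0 < s \<and>
        (\<forall>i\<in>I. s * (b - a \<bullet> p i) + s\<^sup>2 * (norm a)\<^sup>2 / 4 \<le> e i - m)"
      by eventually_elim simp
    then have "\<exists>s>0. \<forall>i\<in>I. s * (b - a \<bullet> p i) + s\<^sup>2 * (norm a)\<^sup>2 / 4 \<le> e i - m"
      by (rule eventually_happens'[OF trivial_limit_at_right_real])
    then obtain s where s: "0 < s"
      "\<And>i. i \<in> I \<Longrightarrow> s * (b - a \<bullet> p i) + s\<^sup>2 * (norm a)\<^sup>2 / 4 \<le> e i - m"
      by blast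
    have "ereal ((m + s * b) + (v - s *\<^sub>R a) \<bullet> u) \<le> f u" for u
    proof (cases "f u = \<infinity>")
      case False
      then obtain i where i: "i \<in> I" "ereal (e i + v \<bullet> u + (norm (u - p i))\<^sup>2) \<le> f u"
        using lower by blast
      have "0 \<le> (norm (u - p i + (s / 2) *\<^sub>R a))\<^sup>2"
        by simp
      also have "\<dots> = (norm (u - p i))\<^sup>2 + s * (a \<bullet> (u - p i)) + s\<^sup>2 * (norm a)\<^sup>2 / 4"
        unfolding power2_norm_eq_inner
        by (simp add: inner_simps inner_commute algebra_simps power2_eq_square)
      finally have "(m + s * b) + (v - s *\<^sub>R a) \<bullet> u \<le> e i + v \<bullet> u + (norm (u - p i))\<^sup>2"
        using s(2)[OF i(1)] by (simp add: inner_simps algebra_simps)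
      then show ?thesis
        using i(2) by (metis ereal_less_eq(3) order_trans)
    qed simp
    then have "ereal ((m + s * b) + (v - s *\<^sub>R a) \<bullet> y) \<le> convex_envelope f y"
      by (rule convex_minorant_le_envelope[OF convex_on_affine])
    then have "s * (b - a \<bullet> y) \<le> 0"
      using val by (simp add: m_def inner_simps algebra_simps)
    then show False
      using s(1) ab(1) by (simp add: mult_le_0_iff)
  qed
  then show "y \<in> convex hull (p ` {i\<in>I. e i = Min (e ` I)})"
    by (simp add: m_def)
qed

section \<open>Local minimizers of a convex function plus a concave quadratic\<close>

text \<open>
  The smooth part of the regularized objective has gradient \<open>-2 z\<close> at \<open>y\<close>; its second
  order term is negative when \<open>A\<close> is a strict contraction, and it is exactly
  what the growth and monotonicity estimates below are weighed against.
\<close>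

lemma least_squares_expansion:
  fixes A :: "real ^ 'n ^ 'm"
  assumes "z = (mat 1 - transpose A ** A) *v y + transpose A *v b"
  shows "(norm (A *v u - b))\<^sup>2 - (norm u)\<^sup>2 =
    (norm (A *v y - b))\<^sup>2 - (norm y)\<^sup>2 - 2 * (z \<bullet> (u - y))
      + (norm (A *v (u - y)))\<^sup>2 - (norm (u - y))\<^sup>2"
proof -
  define w where "w = u - y"
  have u: "u = y + w" by (simp add: w_def)
  have "z \<bullet> w = y \<bullet> w - (A *v y - b) \<bullet> (A *v w)"
    using assms
    by (simp add: inner_simps dot_lmul_matrix matrix_vector_mult_diff_rdistrib
        flip: matrix_vector_mul_assoc)
  then show ?thesis
    unfolding w_def[symmetric]
    by (simp add: u matrix_vector_right_distrib power2_norm_eq_inner inner_simps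
        inner_commute algebra_simps)
qed

lemma local_minimizer_finite_value:
  assumes "local_minimizer (\<lambda>u. h u - ereal (q u) + ereal (r u)) y"
  obtains c where "h y = ereal c"
  using assms by (cases "h y") (auto simp: local_minimizer_def)

text \<open>
  Only the convex part \<open>h\<close> is compared along a whole segment: convexity gives a
  chord bound, local minimality bounds the chord below by the smooth part,
  and dividing by the step length leaves the derivative of the smooth part.
\<close>

lemma local_minimizer_imp_stationary:
  fixes A :: "real ^ 'n ^ 'm"
  assumes convex: "econvex h"
    and loc: "local_minimizer (\<lambda>u. h u - ereal ((norm u)\<^sup>2) + ereal ((norm (A *v u - b))\<^sup>2)) y"
    and z: "z = (mat 1 - transpose A ** A) *v y + transpose A *v b"
  shows "2 *\<^sub>R z \<in> subdifferential h y"
proof -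
  obtain c where c: "h y = ereal c"
    using loc by (rule local_minimizer_finite_value)
  obtain \<epsilon> where \<epsilon>: "0 < \<epsilon>" "\<And>u. dist y u < \<epsilon> \<Longrightarrow>
      h y - ereal ((norm y)\<^sup>2) + ereal ((norm (A *v y - b))\<^sup>2)
        \<le> h u - ereal ((norm u)\<^sup>2) + ereal ((norm (A *v u - b))\<^sup>2)"
    using loc by (auto simp: local_minimizer_def)
  have slope: "c + (2 *\<^sub>R z) \<bullet> (u - y) \<le> d" if d: "h u \<le> ereal d" for u d
  proof -
    define C where "C = (norm (A *v (u - y)))\<^sup>2 - (norm (u - y))\<^sup>2"
    have "\<forall>\<^sub>F t in at_right 0. 2 * (z \<bullet> (u - y)) - t * C \<le> d - c"
    proof -
      have lim: "((\<lambda>t. dist y (y + t *\<^sub>R (u - y))) \<longlongrightarrow> dist y (y + 0 *\<^sub>R (u - y))) (at_right 0)"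
        by (intro tendsto_intros)
      have "\<forall>\<^sub>F t in at_right 0. dist y (y + t *\<^sub>R (u - y)) < \<epsilon>"
        using \<epsilon>(1) by (intro order_tendstoD(2)[OF lim]) simp
      moreover have "\<forall>\<^sub>F t::real in at_right 0. 0 < t"
        by (simp add: eventually_at_right_less)
      moreover have "\<forall>\<^sub>F t::real in at_right 0. t < 1"
        by (rule eventually_at_right_real[THEN eventually_mono]) (auto intro: zero_less_one)
      ultimately show ?thesis
      proof eventually_elim
        case (elim t)
        let ?u = "y + t *\<^sub>R (u - y)"
        have "h ?u \<le> ereal (c + t * (d - c))"
          using elim c d convex by (intro econvexD) auto
        then have "ereal (c - (norm y)\<^sup>2 + (norm (A *v y - b))\<^sup>2)
            \<le> ereal (c + t * (d - c) - (norm ?u)\<^sup>2 + (norm (A *v ?u - b))\<^sup>2)"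
          using \<epsilon>(2)[OF elim(1)] c by (cases "h ?u") auto
        then have "2 * (z \<bullet> (?u - y)) - ((norm (A *v (?u - y)))\<^sup>2 - (norm (?u - y))\<^sup>2) \<le> t * (d - c)"
          using least_squares_expansion[OF z, of ?u] by simp
        then have "t * (2 * (z \<bullet> (u - y)) - t * C) \<le> t * (d - c)"
          by (simp add: matrix_vector_mult_scaleR C_def power_mult_distrib right_diff_distrib power2_eq_square mult.assoc mult.left_commute)
        then show ?case
          using elim by simp
      qed
    qed
    moreover have "((\<lambda>t. 2 * (z \<bullet> (u - y)) - t * C) \<longlongrightarrow> 2 * (z \<bullet> (u - y)) - 0 * C) (at_right 0)"
      by (intro tendsto_intros)
    ultimately have "2 * (z \<bullet> (u - y)) - 0 * C \<le> d - c"
      by (intro tendsto_upperbound) auto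
    then show ?thesis by simp
  qed
  have "ereal (c + (2 *\<^sub>R z) \<bullet> (u - y)) \<le> h u" for u
  proof (rule ereal_le_real)
    fix d assume "h u \<le> ereal d"
    then show "ereal (c + (2 *\<^sub>R z) \<bullet> (u - y)) \<le> ereal d"
      unfolding ereal_less_eq(3) by (rule slope)
  qed
  then show ?thesis
    by (simp add: subdifferential_def c)
qed

text \<open>
  Strict concavity of the smooth part.  Convexity keeps \<open>h\<close> below the affine function
  of slope \<open>2 z\<close> through \<open>y\<close> on the whole segment to \<open>p\<close>; this slope cancels the first
  order of the smooth part, whose second order then makes the objective decrease
  strictly from \<open>y\<close> towards \<open>p\<close> unless the two points agree.
\<close>

lemma local_minimizer_tangent_unique:
  fixes A :: "real ^ 'n ^ 'm"
  assumes convex: "econvex h"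
    and loc: "local_minimizer (\<lambda>u. h u - ereal ((norm u)\<^sup>2) + ereal ((norm (A *v u - b))\<^sup>2)) y"
    and z: "z = (mat 1 - transpose A ** A) *v y + transpose A *v b"
    and contr: "\<And>v. v \<noteq> 0 \<Longrightarrow> norm (A *v v) < norm v"
    and tight: "h p \<le> h y + ereal (2 * (z \<bullet> (p - y)))"
  shows "p = y"
proof (rule ccontr)
  assume "p \<noteq> y"
  define w where "w = p - y"
  have "w \<noteq> 0" using \<open>p \<noteq> y\<close> by (simp add: w_def)
  obtain c where c: "h y = ereal c"
    using loc by (rule local_minimizer_finite_value)
  obtain \<epsilon> where \<epsilon>: "0 < \<epsilon>" "\<And>u. dist y u < \<epsilon> \<Longrightarrow>
      h y - ereal ((norm y)\<^sup>2) + ereal ((norm (A *v y - b))\<^sup>2)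
        \<le> h u - ereal ((norm u)\<^sup>2) + ereal ((norm (A *v u - b))\<^sup>2)"
    using loc by (auto simp: local_minimizer_def)
  define t where "t = min 1 (\<epsilon> / (2 * norm w))"
  have t: "0 < t" "t \<le> 1" "t * norm w < \<epsilon>"
    using \<epsilon>(1) \<open>w \<noteq> 0\<close> by (auto simp: t_def min_def field_simps)
  let ?u = "y + t *\<^sub>R w"
  have "h ?u \<le> ereal (c + t * (c + 2 * (z \<bullet> w) - c))"
    unfolding w_def using t c tight convex by (intro econvexD) auto
  moreover have "dist y ?u < \<epsilon>"
    using t by (simp add: dist_norm)
  ultimately have "ereal (c - (norm y)\<^sup>2 + (norm (A *v y - b))\<^sup>2)
      \<le> ereal (c + t * (2 * (z \<bullet> w)) - (norm ?u)\<^sup>2 + (norm (A *v ?u - b))\<^sup>2)"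
    using \<epsilon>(2)[of ?u] c by (cases "h ?u") auto
  then have "t\<^sup>2 * (norm w)\<^sup>2 \<le> t\<^sup>2 * (norm (A *v w))\<^sup>2"
    using least_squares_expansion[OF z, of ?u]
    by (simp add: matrix_vector_mult_scaleR power_mult_distrib)
  then have "norm w \<le> norm (A *v w)"
    using t(1) by (simp add: power2_le_iff_abs_le)
  then show False
    using contr[OF \<open>w \<noteq> 0\<close>] by simp
qed

section \<open>Sparse vectors and sorted entries\<close>

lemma norm_square_coordinates: "(norm (u :: real ^ 'n))\<^sup>2 = (\<Sum>i\<in>UNIV. (u $ i)\<^sup>2)"
  by (simp add: norm_vec_def L2_set_def sum_nonneg)

lemma inner_coordinates: "(u :: real ^ 'n) \<bullet> v = (\<Sum>i\<in>UNIV. u $ i * v $ i)"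
  by (simp add: inner_vec_def)

lemma sum_restrict_UNIV:
  fixes h :: "'n::finite \<Rightarrow> real"
  assumes "\<And>i. i \<notin> S \<Longrightarrow> h i = 0"
  shows "sum h UNIV = sum h S"
  using assms by (intro sum.mono_neutral_right) auto

lemma nnz_le_dimension: "nnz (u :: real ^ 'n) \<le> CARD('n)"
  unfolding nnz_def by (rule card_mono) auto

lemma nnz_eq_0: "nnz u = 0 \<longleftrightarrow> u = 0"
  by (simp add: nnz_def vec_eq_iff)

lemma nnz_zero [simp]: "nnz 0 = 0"
  by (simp add: nnz_eq_0)

lemma nnz_diff_le: "nnz (u - v) \<le> nnz u + nnz v"
proof -
  have "nnz (u - v) \<le> card ({i. u $ i \<noteq> 0} \<union> {i. v $ i \<noteq> 0})"
    unfolding nnz_def by (rule card_mono) auto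
  also have "\<dots> \<le> nnz u + nnz v"
    unfolding nnz_def by (rule card_Un_le)
  finally show ?thesis .
qed

definition restrict_support :: "'n set \<Rightarrow> real ^ 'n \<Rightarrow> real ^ 'n" where
  "restrict_support S z = (\<chi> i. if i \<in> S then z $ i else 0)"

lemma restrict_support_nth [simp]:
  "restrict_support S z $ i = (if i \<in> S then z $ i else 0)"
  by (simp add: restrict_support_def)

lemma norm_restrict_le_l1:
  fixes u :: "real ^ 'n"
  shows "norm (restrict_support S u) \<le> (\<Sum>i\<in>S. \<bar>u $ i\<bar>)"
proof -
  have "norm (restrict_support S u) \<le> (\<Sum>i\<in>UNIV. \<bar>restrict_support S u $ i\<bar>)"
    by (rule norm_le_l1_cart)
  also have "\<dots> = (\<Sum>i\<in>S. \<bar>u $ i\<bar>)"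
    by (subst sum_restrict_UNIV[of S]) auto
  finally show ?thesis .
qed

lemma restrict_support_orthogonal:
  "restrict_support S u \<bullet> restrict_support (- S) u = 0"
  unfolding inner_coordinates by (rule sum.neutral) auto

lemma restrict_support_add:
  "restrict_support S u + restrict_support (- S) u = u"
  by (simp add: vec_eq_iff)

text \<open>
  Sorting is used only through this consequence: a set of \<open>k\<close> positions carries
  the \<open>k\<close> largest absolute values, and two consecutive sorted values \<open>s\<close> and \<open>t\<close>
  separate it from its complement.
\<close>

lemma sorted_abs_split:
  fixes v :: "real ^ 'n"
  assumes "1 \<le> k" "k \<le> CARD('n)"
  obtains S s t where "card S = k" "sorted_abs v k = ereal s" "sorted_abs v (k + 1) = ereal t"
    "0 \<le> t" "t \<le> s" "\<And>i. i \<in> S \<Longrightarrow> s \<le> \<bar>v $ i\<bar>" "\<And>i. i \<notin> S \<Longrightarrow> \<bar>v $ i\<bar> \<le> t"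
    "\<exists>i\<in>S. \<bar>v $ i\<bar> = s"
proof -
  obtain L0 where L0: "mset L0 = mset_set (UNIV :: 'n set)"
    using ex_mset by blast
  define L where "L = rev (sort_key (\<lambda>i. \<bar>v $ i\<bar>) L0)"
  have mset_L: "mset L = mset_set UNIV"
    by (simp add: L_def L0)
  have "sorted_list_of_multiset (image_mset (\<lambda>i. \<bar>v $ i\<bar>) (mset_set UNIV))
      = sort (map (\<lambda>i. \<bar>v $ i\<bar>) L0)"
    by (metis L0 mset_map sorted_list_of_multiset_mset)
  also have "\<dots> = map (\<lambda>i. \<bar>v $ i\<bar>) (sort_key (\<lambda>i. \<bar>v $ i\<bar>) L0)"
    by (rule properties_for_sort) simp_all
  finally have list: "sorted_abs_list v = map (\<lambda>i. \<bar>v $ i\<bar>) L"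
    by (simp add: sorted_abs_list_def L_def rev_map)
  have set_L: "set L = UNIV"
    by (metis finite_class.finite_UNIV finite_set_mset_mset_set mset_L set_mset_mset)
  have dist: "distinct L"
    by (metis count_mset_set(1,3) distinct_count_atmost_1 finite_class.finite_UNIV iso_tuple_UNIV_I mset_L set_L)
  have len: "length L = CARD('n)"
    using distinct_card[OF dist] set_L by simp
  have desc: "\<bar>v $ (L ! j)\<bar> \<le> \<bar>v $ (L ! i)\<bar>" if "i \<le> j" "j < CARD('n)" for i j
  proof -
    have "sorted (rev (map (\<lambda>i. \<bar>v $ i\<bar>) L))"
      by (simp add: L_def rev_map)
    then show ?thesis
      using that len sorted_rev_nth_mono[of "map (\<lambda>i. \<bar>v $ i\<bar>) L" i j] by simp
  qed
  have val: "sorted_abs v j = ereal \<bar>v $ (L ! (j - 1))\<bar>" if "1 \<le> j" "j \<le> CARD('n)" for j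
    using that by (simp add: sorted_abs_def list len)
  define S where "S = set (take k L)"
  define s where "s = \<bar>v $ (L ! (k - 1))\<bar>"
  define t where "t = (if k < CARD('n) then \<bar>v $ (L ! k)\<bar> else 0)"
  show thesis
  proof (rule that[of S s t])
    show "card S = k"
      unfolding S_def using dist len assms by (simp add: distinct_card)
    show "sorted_abs v k = ereal s"
      using val[of k] assms by (simp add: s_def)
    show "sorted_abs v (k + 1) = ereal t"
      using val[of "k + 1"] assms by (auto simp: t_def sorted_abs_def zero_ereal_def)
    show "0 \<le> t"
      by (simp add: t_def)
    show "t \<le> s"
      using desc[of "k - 1" k] by (simp add: t_def s_def)
    show "s \<le> \<bar>v $ i\<bar>" if i: "i \<in> S" for i
    proof -
      obtain j where "j < k" "i = L ! j"
        using i assms len by (auto simp: S_def in_set_conv_nth)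
      then show ?thesis
        using desc[of j "k - 1"] assms by (simp add: s_def)
    qed
    show "\<bar>v $ i\<bar> \<le> t" if i: "i \<notin> S" for i
    proof -
      obtain j where j: "j < CARD('n)" "i = L ! j"
        using set_L len by (metis UNIV_I in_set_conv_nth)
      have "\<not> j < k"
      proof
        assume "j < k"
        then have "take k L ! j = i" "j < length (take k L)"
          using j assms len by auto
        then show False
          using i unfolding S_def by (metis nth_mem)
      qed
      then show ?thesis
        using desc[of k j] j by (simp add: t_def)
    qed
    have "L ! (k - 1) \<in> S"
    proof -
      have "take k L ! (k - 1) = L ! (k - 1)" "k - 1 < length (take k L)"
        using assms len by auto
      then show ?thesis
        unfolding S_def by (metis nth_mem)
    qed
    then show "\<exists>i\<in>S. \<bar>v $ i\<bar> = s"
      by (auto simp: s_def)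
  qed
qed

section \<open>Optimal supports\<close>

text \<open>
  This is the minimum of \<open>G (card S) + (norm u)\<^sup>2 - 2 * (z \<bullet> u)\<close> over vectors \<open>u\<close>
  that vanish off \<open>S\<close>, with \<open>G\<close> the partial sums of \<open>\<gamma>\<close>; it is attained at
  \<open>restrict_support S z\<close>.
\<close>

definition support_cost :: "(nat \<Rightarrow> real) \<Rightarrow> real ^ 'n \<Rightarrow> 'n set \<Rightarrow> real" where
  "support_cost \<gamma> z S = (\<Sum>i\<le>card S. \<gamma> i) - (\<Sum>i\<in>S. (z $ i)\<^sup>2)"

definition optimal_support :: "(nat \<Rightarrow> real) \<Rightarrow> nat \<Rightarrow> real ^ 'n \<Rightarrow> 'n set \<Rightarrow> bool" where
  "optimal_support \<gamma> k z S \<longleftrightarrow> card S \<le> k \<and>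
     (\<forall>T. card T \<le> k \<longrightarrow> support_cost \<gamma> z S \<le> support_cost \<gamma> z T)"

lemma optimal_support_exchange:
  fixes z :: "real ^ 'n"
  assumes "optimal_support \<gamma> k z S" "i \<notin> S" "l \<in> S"
  shows "\<bar>z $ i\<bar> \<le> \<bar>z $ l\<bar>"
proof -
  let ?T = "insert i (S - {l})"
  have card: "card ?T = card S"
    using assms card_Suc_Diff1[of S l] by simp
  then have "support_cost \<gamma> z S \<le> support_cost \<gamma> z ?T"
    using assms(1) by (simp add: optimal_support_def)
  moreover have "(\<Sum>j\<in>S. (z $ j)\<^sup>2) = (z $ l)\<^sup>2 + (\<Sum>j\<in>S - {l}. (z $ j)\<^sup>2)"
    using assms by (intro sum.remove) auto
  ultimately show ?thesis
    using assms card by (simp add: support_cost_def abs_le_square_iff)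
qed

lemma optimal_support_extension:
  fixes z :: "real ^ 'n"
  assumes "optimal_support \<gamma> k z S" "i \<notin> S" "card S < k"
  shows "(z $ i)\<^sup>2 \<le> \<gamma> (Suc (card S))"
proof -
  have "support_cost \<gamma> z S \<le> support_cost \<gamma> z (insert i S)"
    using assms by (simp add: optimal_support_def)
  then show ?thesis
    using assms by (simp add: support_cost_def)
qed

lemma hull_restrictions_coordinate_le:
  fixes z :: "real ^ 'n"
  assumes "y \<in> convex hull ((\<lambda>S. restrict_support S z) ` \<S>)"
  shows "\<bar>y $ i\<bar> \<le> \<bar>z $ i\<bar>"
proof -
  have "linear (\<lambda>v :: real ^ 'n. v $ i)"
    by (rule linearI) auto
  then have "convex ((\<lambda>v :: real ^ 'n. v $ i) -` {- \<bar>z $ i\<bar>..\<bar>z $ i\<bar>})"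
    by (rule convex_linear_vimage) simp
  moreover have "(\<lambda>S. restrict_support S z) ` \<S> \<subseteq> (\<lambda>v. v $ i) -` {- \<bar>z $ i\<bar>..\<bar>z $ i\<bar>}"
    by auto
  ultimately have "y \<in> (\<lambda>v. v $ i) -` {- \<bar>z $ i\<bar>..\<bar>z $ i\<bar>}"
    using assms hull_minimal by blast
  then show ?thesis by auto
qed

section \<open>The sparse objective\<close>

text \<open>
  The function \<open>f_g\<close> when the penalty increments are finite up to \<open>k\<close> and infinite
  afterwards, with the finite increments taken as reals.
\<close>

definition sparse_objective :: "(nat \<Rightarrow> real) \<Rightarrow> nat \<Rightarrow> real ^ 'n \<Rightarrow> ereal" where
  "sparse_objective \<gamma> k u =
     (if nnz u \<le> k then ereal ((\<Sum>i\<le>nnz u. \<gamma> i) + (norm u)\<^sup>2) else \<infinity>)"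

text \<open>
  Completing the square on the support of \<open>u\<close>; with the next lemma this presents the
  objective as a finite family of paraboloids with vertices \<open>restrict_support S z\<close>.
\<close>

lemma sparse_objective_lower:
  fixes z :: "real ^ 'n"
  shows "sparse_objective \<gamma> k u = \<infinity> \<or>
    (\<exists>S\<in>{S. card S \<le> k}. ereal (support_cost \<gamma> z S + (2 *\<^sub>R z) \<bullet> u
       + (norm (u - restrict_support S z))\<^sup>2) \<le> sparse_objective \<gamma> k u)"
proof (cases "nnz u \<le> k")
  case True
  define S where "S = {i. u $ i \<noteq> 0}"
  have S: "card S = nnz u"
    by (simp add: S_def nnz_def)
  have "(norm (u - restrict_support S z))\<^sup>2 = (\<Sum>i\<in>S. (u $ i - z $ i)\<^sup>2)"
    unfolding norm_square_coordinates
    by (subst sum_restrict_UNIV[of S]) (auto simp: S_def)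
  moreover have "(norm u)\<^sup>2 = (\<Sum>i\<in>S. (u $ i)\<^sup>2)"
    unfolding norm_square_coordinates by (rule sum_restrict_UNIV) (auto simp: S_def)
  moreover have "(2 *\<^sub>R z) \<bullet> u = (\<Sum>i\<in>S. 2 * z $ i * u $ i)"
    unfolding inner_coordinates by (subst sum_restrict_UNIV[of S]) (auto simp: S_def)
  moreover have "(\<Sum>i\<in>S. (u $ i)\<^sup>2) =
      (\<Sum>i\<in>S. (u $ i - z $ i)\<^sup>2) + (\<Sum>i\<in>S. 2 * z $ i * u $ i) - (\<Sum>i\<in>S. (z $ i)\<^sup>2)"
    unfolding sum.distrib[symmetric] sum_subtractf[symmetric]
    by (rule sum.cong) (auto simp: power2_eq_square algebra_simps)
  ultimately have "support_cost \<gamma> z S + (2 *\<^sub>R z) \<bullet> u + (norm (u - restrict_support S z))\<^sup>2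
      = (\<Sum>i\<le>nnz u. \<gamma> i) + (norm u)\<^sup>2"
    by (simp add: support_cost_def S)
  then show ?thesis
    using True S by (intro disjI2 bexI[of _ S]) (auto simp: sparse_objective_def)
qed (simp add: sparse_objective_def)

lemma sparse_objective_upper:
  fixes z :: "real ^ 'n"
  assumes "\<And>i. i \<le> k \<Longrightarrow> 0 \<le> \<gamma> i" and "card S \<le> k"
  shows "sparse_objective \<gamma> k (restrict_support S z) \<le>
    ereal (support_cost \<gamma> z S + (2 *\<^sub>R z) \<bullet> restrict_support S z)"
proof -
  let ?u = "restrict_support S z"
  have nnz: "nnz ?u \<le> card S"
    unfolding nnz_def by (rule card_mono) auto
  then have "(\<Sum>i\<le>nnz ?u. \<gamma> i) \<le> (\<Sum>i\<le>card S. \<gamma> i)"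
    using assms by (intro sum_mono2) auto
  moreover have "(norm ?u)\<^sup>2 = (\<Sum>i\<in>S. (z $ i)\<^sup>2)"
    unfolding norm_square_coordinates by (subst sum_restrict_UNIV[of S]) auto
  moreover have "(2 *\<^sub>R z) \<bullet> ?u = 2 * (\<Sum>i\<in>S. (z $ i)\<^sup>2)"
    unfolding inner_coordinates sum_distrib_left
    by (subst sum_restrict_UNIV[of S]) (auto simp: power2_eq_square mult.assoc)
  ultimately show ?thesis
    using nnz assms(2) by (simp add: sparse_objective_def support_cost_def)
qed

text \<open>
  The last part says that the affine function supporting the envelope at \<open>y\<close> is
  attained at every vertex coming from an optimal support, which is what
  \<open>local_minimizer_tangent_unique\<close> consumes.
\<close>

lemma stationary_sparse_objective:
  fixes z :: "real ^ 'n"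
  assumes "\<And>i. i \<le> k \<Longrightarrow> 0 \<le> \<gamma> i"
    and "2 *\<^sub>R z \<in> subdifferential (convex_envelope (sparse_objective \<gamma> k)) y"
  shows "\<exists>S. optimal_support \<gamma> k z S"
    and "y \<in> convex hull ((\<lambda>S. restrict_support S z) ` {S. optimal_support \<gamma> k z S})"
    and "optimal_support \<gamma> k z S \<Longrightarrow>
      convex_envelope (sparse_objective \<gamma> k) (restrict_support S z)
        \<le> convex_envelope (sparse_objective \<gamma> k) y + ereal (2 * (z \<bullet> (restrict_support S z - y)))"
proof -
  let ?I = "{S :: 'n set. card S \<le> k}"
  have fin: "finite ?I" by simp
  have ne: "?I \<noteq> {}" by (auto intro: exI[of _ "{}"])
  define m where "m = Min (support_cost \<gamma> z ` ?I)"
  have upper: "sparse_objective \<gamma> k (restrict_support S z)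
      \<le> ereal (support_cost \<gamma> z S + (2 *\<^sub>R z) \<bullet> restrict_support S z)" if "S \<in> ?I" for S
    using assms(1) that by (intro sparse_objective_upper) auto
  note vh = stationary_value_and_hull[where p = "\<lambda>S. restrict_support S z"
      and e = "support_cost \<gamma> z", OF fin ne assms(2) sparse_objective_lower upper, folded m_def]
  have "m \<in> support_cost \<gamma> z ` ?I"
    unfolding m_def using fin ne by (intro Min_in) auto
  then obtain S\<^sub>0 where S\<^sub>0: "S\<^sub>0 \<in> ?I" "support_cost \<gamma> z S\<^sub>0 = m"
    by auto
  have m_le: "m \<le> support_cost \<gamma> z S" if "S \<in> ?I" for S
    unfolding m_def using fin that by (intro Min_le) auto
  have opt: "optimal_support \<gamma> k z S \<longleftrightarrow> S \<in> ?I \<and> support_cost \<gamma> z S = m" for S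
  proof
    assume "optimal_support \<gamma> k z S"
    then have "S \<in> ?I" "support_cost \<gamma> z S \<le> support_cost \<gamma> z S\<^sub>0"
      using S\<^sub>0(1) by (auto simp: optimal_support_def)
    then show "S \<in> ?I \<and> support_cost \<gamma> z S = m"
      using m_le[of S] S\<^sub>0(2) by simp
  next
    assume "S \<in> ?I \<and> support_cost \<gamma> z S = m"
    then show "optimal_support \<gamma> k z S"
      using m_le by (simp add: optimal_support_def)
  qed
  show "\<exists>S. optimal_support \<gamma> k z S"
    using S\<^sub>0 opt by blast
  show "y \<in> convex hull ((\<lambda>S. restrict_support S z) ` {S. optimal_support \<gamma> k z S})"
  proof -
    have "{S. optimal_support \<gamma> k z S} = {S \<in> ?I. support_cost \<gamma> z S = m}"
      using opt by blast
    then show ?thesis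
      using vh(2) by simp
  qed
  assume S: "optimal_support \<gamma> k z S"
  have "convex_envelope (sparse_objective \<gamma> k) (restrict_support S z)
      \<le> sparse_objective \<gamma> k (restrict_support S z)"
    by (rule le_funD[OF convex_envelope_le])
  also have "\<dots> \<le> ereal (support_cost \<gamma> z S + (2 *\<^sub>R z) \<bullet> restrict_support S z)"
    using S by (intro upper) (simp add: optimal_support_def)
  also have "\<dots> = convex_envelope (sparse_objective \<gamma> k) y
      + ereal (2 * (z \<bullet> (restrict_support S z - y)))"
    using vh(1) S[unfolded opt] by (simp add: inner_diff_right)
  finally show "convex_envelope (sparse_objective \<gamma> k) (restrict_support S z)
        \<le> convex_envelope (sparse_objective \<gamma> k) y + ereal (2 * (z \<bullet> (restrict_support S z - y)))" .
qed

lemma G_g_truncated: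
  assumes "\<And>i. i \<le> k \<Longrightarrow> g i = ereal (\<gamma> i)" "\<And>i. k < i \<Longrightarrow> i \<le> n \<Longrightarrow> g i = \<infinity>" "j \<le> n"
  shows "G_g g j = (if j \<le> k then ereal (\<Sum>i\<le>j. \<gamma> i) else \<infinity>)"
proof (cases "j \<le> k")
  case True
  then have "G_g g j = (\<Sum>i\<le>j. ereal (\<gamma> i))"
    unfolding G_g_def using assms(1) by (intro sum.cong) auto
  then show ?thesis using True by simp
next
  case False
  then show ?thesis
    unfolding G_g_def using assms(2)[of j] assms(3) by (auto simp: sum_Pinfty intro!: bexI[of _ j])
qed

lemma econvex_sparse_objective_0:
  "econvex (sparse_objective \<gamma> 0 :: real ^ 'n \<Rightarrow> ereal)"
proof -
  have "{(u :: real ^ 'n, r). sparse_objective \<gamma> 0 u \<le> ereal r} = {0} \<times> {\<gamma> 0..}"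
  proof -
    have "sparse_objective \<gamma> 0 u \<le> ereal r \<longleftrightarrow> u = 0 \<and> \<gamma> 0 \<le> r" for u :: "real ^ 'n" and r
      by (cases "u = 0") (simp_all add: sparse_objective_def nnz_eq_0)
    then show ?thesis by auto
  qed
  then show ?thesis
    by (simp add: econvex_def convex_Times)
qed

section \<open>Growth at a well separated support\<close>

text \<open>
  Used to compare two supports: indices lost (\<open>W\<close>) are matched with indices
  gained (\<open>V\<close>), and lost indices have to be positive on their own only if some of them
  remain unmatched.
\<close>

lemma sum_pos_by_pairing:
  fixes p :: "'a \<Rightarrow> real" and r :: "'b \<Rightarrow> real"
  assumes "finite V" "finite W" "card V \<le> card W" "W \<noteq> {}"
    and pair: "\<And>i l. i \<in> W \<Longrightarrow> l \<in> V \<Longrightarrow> 0 < p i + r l"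
    and unpaired: "\<And>i. card V < card W \<Longrightarrow> i \<in> W \<Longrightarrow> 0 < p i"
  shows "0 < sum p W + sum r V"
proof -
  obtain \<pi> where \<pi>: "\<pi> ` V \<subseteq> W" "inj_on \<pi> V"
    using card_le_inj[OF assms(1-3)] by blast
  have "sum p W = sum p (W - \<pi> ` V) + sum p (\<pi> ` V)"
    using \<pi> \<open>finite W\<close> by (metis sum.subset_diff)
  also have "sum p (\<pi> ` V) = (\<Sum>l\<in>V. p (\<pi> l))"
    using \<pi>(2) by (simp add: sum.reindex)
  finally have eq: "sum p W + sum r V = sum p (W - \<pi> ` V) + (\<Sum>l\<in>V. p (\<pi> l) + r l)"
    by (simp add: sum.distrib)
  have rest: "0 \<le> sum p (W - \<pi> ` V)"
  proof (cases "card V < card W")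
    case True
    then show ?thesis
      using unpaired by (intro sum_nonneg) (auto intro: less_imp_le)
  next
    case False
    then have "\<pi> ` V = W"
      using \<pi> assms by (intro card_subset_eq) (auto simp: card_image)
    then show ?thesis by simp
  qed
  show ?thesis
  proof (cases "V = {}")
    case True
    then have "card V < card W"
      using assms by (simp add: card_gt_0_iff)
    then show ?thesis
      using True assms(2,4) unpaired by (auto intro: sum_pos)
  next
    case False
    then have "0 < (\<Sum>l\<in>V. p (\<pi> l) + r l)"
      using \<pi> assms(1) pair by (intro sum_pos) auto
    then show ?thesis
      using eq rest by simp
  qed
qed

lemma sum_UNIV_split_two_sets:
  fixes h :: "'n::finite \<Rightarrow> real"
  assumes "\<And>i. i \<notin> S \<Longrightarrow> i \<notin> T \<Longrightarrow> h i = 0"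
  shows "sum h UNIV = sum h (S \<inter> T) + (sum h (S - T) + sum h (T - S))"
proof -
  have "sum h UNIV = sum h (S \<union> T)"
    using assms by (intro sum.mono_neutral_right) auto
  also have "S \<union> T = (S \<inter> T) \<union> ((S - T) \<union> (T - S))"
    by auto
  also have "sum h \<dots> = sum h (S \<inter> T) + (sum h (S - T) + sum h (T - S))"
    by (subst sum.union_disjoint; (subst sum.union_disjoint)?) auto
  finally show ?thesis .
qed

text \<open>
  The situation at the given stationary point: \<open>S\<close> carries the \<open>k\<close> largest entries of \<open>z\<close>,
  they exceed the remaining ones by the factor \<open>1 / (1 - 2 * \<delta>)\<close>, and they exceed the
  threshold \<open>sqrt (\<gamma> k)\<close> by the factor \<open>1 / (1 - \<delta>)\<close>.
\<close>

locale separated_support =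
  fixes \<gamma> :: "nat \<Rightarrow> real" and k :: nat and z :: "real ^ 'n" and S :: "'n set" and s t \<delta> :: real
  assumes \<gamma>_nonneg: "\<And>i. i \<le> k \<Longrightarrow> 0 \<le> \<gamma> i"
    and \<gamma>_le: "\<And>i. i \<le> k \<Longrightarrow> \<gamma> i \<le> \<gamma> k"
    and card_S: "card S = k"
    and \<delta>: "0 < \<delta>" "\<delta> < 1 / 2"
    and large: "\<And>i. i \<in> S \<Longrightarrow> s \<le> \<bar>z $ i\<bar>"
    and small: "\<And>i. i \<notin> S \<Longrightarrow> \<bar>z $ i\<bar> \<le> t"
    and t: "0 \<le> t" "t < (1 - 2 * \<delta>) * s"
    and threshold: "sqrt (\<gamma> k) < (1 - \<delta>) * s"
begin

lemma s_pos: "0 < s"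
  using t \<delta> by (auto simp: zero_less_mult_iff dest: order_le_less_trans)

lemma t_less_s: "t < s"
proof -
  have "(1 - 2 * \<delta>) * s \<le> 1 * s"
    using \<delta> s_pos by (intro mult_right_mono) auto
  then show ?thesis using t by simp
qed

lemma threshold_square: "\<gamma> k < ((1 - \<delta>) * s)\<^sup>2"
  using threshold \<gamma>_nonneg[of k]
  by (metis le_refl power_strict_mono real_sqrt_ge_zero real_sqrt_pow2 zero_less_numeral)

lemma \<gamma>_less_square:
  assumes "i \<in> S"
  shows "\<gamma> k < (1 - \<delta>) * (z $ i)\<^sup>2"
proof -
  have "(1 - \<delta>)\<^sup>2 \<le> 1 - \<delta>"
    using \<delta> by (simp add: power2_eq_square mult_left_le)
  moreover have "s\<^sup>2 \<le> (z $ i)\<^sup>2"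
    using large[OF assms] s_pos by (simp add: abs_le_square_iff[symmetric])
  ultimately have "(1 - \<delta>)\<^sup>2 * s\<^sup>2 \<le> (1 - \<delta>) * (z $ i)\<^sup>2"
    using \<delta> by (intro mult_mono) auto
  then show ?thesis
    using threshold_square by (simp add: power_mult_distrib)
qed

text \<open>
  A smaller support would gain from adding an entry above the threshold, and one of
  size \<open>k\<close> other than \<open>S\<close> would gain from exchanging an entry.
\<close>

lemma unique_optimal_support:
  assumes T: "optimal_support \<gamma> k z T"
  shows "T = S"
proof (rule ccontr)
  assume "T \<noteq> S"
  have "card T \<le> k"
    using T by (simp add: optimal_support_def)
  then obtain i where i: "i \<in> S" "i \<notin> T"
    using \<open>T \<noteq> S\<close> card_S card_seteq[of T S] by auto
  have zi: "\<gamma> k < (z $ i)\<^sup>2"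
  proof -
    have "(1 - \<delta>) * (z $ i)\<^sup>2 \<le> 1 * (z $ i)\<^sup>2"
      using \<delta> by (intro mult_right_mono) auto
    then show ?thesis
      using \<gamma>_less_square[OF i(1)] by simp
  qed
  show False
  proof (cases "card T < k")
    case True
    then show False
      using optimal_support_extension[OF T i(2)] \<gamma>_le[of "Suc (card T)"] zi by simp
  next
    case False
    have "\<not> T \<subseteq> S"
    proof
      assume "T \<subseteq> S"
      then have "T = S"
        using False \<open>card T \<le> k\<close> card_S by (intro card_subset_eq) auto
      then show False
        using \<open>T \<noteq> S\<close> by simp
    qed
    then obtain l where "l \<in> T" "l \<notin> S" by blast
    then show False
      using optimal_support_exchange[OF T i(2)] large[OF i(1)] small t_less_s by fastforce
  qed
qed

text \<open>
  Each missing index saves at most \<open>\<gamma> k\<close>; this is what lets the penalty be charged to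
  the unmatched indices when supports are paired.
\<close>

lemma penalty_growth:
  assumes "j \<le> k"
  shows "(\<Sum>i\<le>k. \<gamma> i) \<le> (\<Sum>i\<le>j. \<gamma> i) + real (k - j) * \<gamma> k"
proof -
  have "(\<Sum>i\<le>k. \<gamma> i) = (\<Sum>i\<in>{..k} - {..j}. \<gamma> i) + (\<Sum>i\<le>j. \<gamma> i)"
    using assms by (intro sum.subset_diff) auto
  moreover have "(\<Sum>i\<in>{..k} - {..j}. \<gamma> i) \<le> real (card ({..k} - {..j})) * \<gamma> k"
    using \<gamma>_le by (intro sum_bounded_above) auto
  moreover have "card ({..k} - {..j}) = k - j"
    using assms by (subst card_Diff_subset) auto
  ultimately show ?thesis by simp
qed

text \<open>
  Rate at which entries off \<open>S\<close> are charged linearly.  It is chosen so that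
  \<open>2 * t + slope = 2 * (1 - 2 * \<delta>) * s\<close>: trading an entry on \<open>S\<close> for an entry \<open>r\<close> off \<open>S\<close>
  then still costs at least \<open>(1 - \<delta>) * (s - \<bar>r\<bar>)\<^sup>2 + 2 * \<delta> * s * \<bar>r\<bar>\<close>.
\<close>

definition slope :: real where
  "slope = 2 * ((1 - 2 * \<delta>) * s - t)"

lemma slope_pos: "0 < slope"
  using t by (simp add: slope_def)

lemma nnz_restrict: "nnz (restrict_support S z) = k"
proof -
  have "{i. restrict_support S z $ i \<noteq> 0} = S"
    using large s_pos by force
  then show ?thesis by (simp add: nnz_def card_S)
qed

text \<open>
  The key estimate.  The objective exceeds its supporting affine function at \<open>x\<close> by
  \<open>\<delta> * (norm (u - x))\<^sup>2\<close>, which is what the restricted isometry can lose, plus a term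
  linear in the entries off \<open>S\<close>.  The claim is a sum over coordinates.  On common
  indices the summand is \<open>(1 - \<delta>) * (u $ i - z $ i)\<^sup>2\<close>.  A lost index contributes \<open>(1 - \<delta>) * (z $ i)\<^sup>2\<close>, which
  pays for one penalty increment \<open>\<gamma> k\<close> if it is unmatched, and for the cross term of
  the gained index that it is matched with otherwise.
\<close>

lemma quadratic_growth:
  fixes u :: "real ^ 'n"
  defines "x \<equiv> restrict_support S z"
  shows "ereal ((\<Sum>i\<le>k. \<gamma> i) + (norm x)\<^sup>2 + 2 * (z \<bullet> (u - x)) + \<delta> * (norm (u - x))\<^sup>2
      + slope * (\<Sum>i\<in>-S. \<bar>u $ i\<bar>)) \<le> sparse_objective \<gamma> k u"
proof (cases "nnz u \<le> k")
  case True
  define U where "U = {i. u $ i \<noteq> 0}"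
  have U: "card U \<le> k" "card U = nnz u"
    using True by (simp_all add: U_def nnz_def)
  define h where "h i = (u $ i)\<^sup>2 - (x $ i)\<^sup>2 - 2 * z $ i * (u $ i - x $ i) - \<delta> * (u $ i - x $ i)\<^sup>2
      - (if i \<in> S then 0 else slope * \<bar>u $ i\<bar>)" for i
  have "sum h UNIV = (norm u)\<^sup>2 - (norm x)\<^sup>2 - 2 * (z \<bullet> (u - x)) - \<delta> * (norm (u - x))\<^sup>2
      - slope * (\<Sum>i\<in>-S. \<bar>u $ i\<bar>)"
  proof -
    have "(\<Sum>i\<in>UNIV. if i \<in> S then 0 else slope * \<bar>u $ i\<bar>) = slope * (\<Sum>i\<in>-S. \<bar>u $ i\<bar>)"
      unfolding sum_distrib_left by (subst sum_restrict_UNIV[of "-S"]) auto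
    then show ?thesis
      unfolding h_def norm_square_coordinates inner_coordinates
      by (simp add: sum_subtractf sum_distrib_left mult.assoc)
  qed
  moreover have "sum h UNIV = sum h (S \<inter> U) + (sum h (S - U) + sum h (U - S))"
    by (rule sum_UNIV_split_two_sets) (auto simp: h_def x_def U_def)
  moreover have "0 \<le> sum h (S \<inter> U)"
  proof (rule sum_nonneg)
    fix i assume "i \<in> S \<inter> U"
    then have "h i = (1 - \<delta>) * (u $ i - z $ i)\<^sup>2"
      by (simp add: h_def x_def power2_eq_square algebra_simps)
    then show "0 \<le> h i"
      using \<delta> by simp
  qed
  moreover have "real (k - card U) * \<gamma> k \<le> sum h (S - U) + sum h (U - S)"
  proof (cases "S - U = {}")
    case True
    then have "U = S"
      using U card_S by (metis Diff_eq_empty_iff card_seteq finite_class.finite_UNIV finite_subset top_greatest)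
    then show ?thesis
      using card_S by simp
  next
    case False
    have card_S_split: "card S = card (S \<inter> U) + card (S - U)"
      by (rule card_Int_Diff) simp
    have card_U_split: "card U = card (S \<inter> U) + card (U - S)"
      by (subst card_Int_Diff[of U S]) (simp_all add: Int_commute)
    \<comment> \<open>Shifting by \<open>\<gamma> k\<close> cancels in every pair and leaves one increment per unmatched index.\<close>
    have "0 < (\<Sum>i\<in>S - U. h i - \<gamma> k) + (\<Sum>l\<in>U - S. h l + \<gamma> k)"
    proof (rule sum_pos_by_pairing)
      show "card (U - S) \<le> card (S - U)"
        using card_S_split card_U_split U card_S by simp
      show "0 < h i - \<gamma> k" if "i \<in> S - U" for i
      proof -
        have "h i = (1 - \<delta>) * (z $ i)\<^sup>2"
          using that by (simp add: h_def x_def U_def power2_eq_square algebra_simps)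
        then show ?thesis
          using \<gamma>_less_square[of i] that by simp
      qed
      show "0 < (h i - \<gamma> k) + (h l + \<gamma> k)" if i: "i \<in> S - U" and l: "l \<in> U - S" for i l
      proof -
        have hi: "h i = (1 - \<delta>) * (z $ i)\<^sup>2"
          using i by (simp add: h_def x_def U_def power2_eq_square algebra_simps)
        have "z $ l * u $ l \<le> t * \<bar>u $ l\<bar>"
          using small[of l] l by (metis DiffD2 abs_ge_self abs_ge_zero abs_mult mult_right_mono order_trans)
        then have hl: "(1 - \<delta>) * (u $ l)\<^sup>2 - 2 * (1 - 2 * \<delta>) * s * \<bar>u $ l\<bar> \<le> h l"
          using l by (simp add: h_def x_def slope_def algebra_simps)
        have "s\<^sup>2 \<le> (z $ i)\<^sup>2"
          using large[of i] i s_pos by (simp add: abs_le_square_iff[symmetric])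
        then have "(1 - \<delta>) * s\<^sup>2 \<le> h i"
          unfolding hi using \<delta> by (intro mult_left_mono) auto
        moreover have "0 < (1 - \<delta>) * (s - \<bar>u $ l\<bar>)\<^sup>2 + 2 * \<delta> * s * \<bar>u $ l\<bar>"
        proof -
          have "0 \<le> (1 - \<delta>) * (s - \<bar>u $ l\<bar>)\<^sup>2" "0 < 2 * \<delta> * s * \<bar>u $ l\<bar>"
            using \<delta> s_pos l by (auto simp: U_def)
          then show ?thesis by simp
        qed
        moreover have "(1 - \<delta>) * (s - \<bar>u $ l\<bar>)\<^sup>2 + 2 * \<delta> * s * \<bar>u $ l\<bar> =
            (1 - \<delta>) * s\<^sup>2 + ((1 - \<delta>) * (u $ l)\<^sup>2 - 2 * (1 - 2 * \<delta>) * s * \<bar>u $ l\<bar>)"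
          by (simp add: power2_eq_square algebra_simps)
        ultimately show ?thesis
          using hl by linarith
      qed
    qed (use False in auto)
    also have "\<dots> = sum h (S - U) + sum h (U - S) - (real (card (S - U)) - real (card (U - S))) * \<gamma> k"
      by (simp add: sum_subtractf sum.distrib algebra_simps)
    also have "real (card (S - U)) - real (card (U - S)) = real (k - card U)"
      using card_S_split card_U_split U card_S by simp
    finally show ?thesis by simp
  qed
  ultimately show ?thesis
    using penalty_growth[OF U(1)] True by (simp add: sparse_objective_def U(2))
qed (simp add: sparse_objective_def)

text \<open>
  The lower bound is a convex function of \<open>u\<close>, so it passes to the envelope.
\<close>

lemma envelope_quadratic_growth:
  fixes u :: "real ^ 'n"
  defines "x \<equiv> restrict_support S z"
  shows "ereal ((\<Sum>i\<le>k. \<gamma> i) + (norm x)\<^sup>2 + 2 * (z \<bullet> (u - x)) + \<delta> * (norm (u - x))\<^sup>2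
      + slope * (\<Sum>i\<in>-S. \<bar>u $ i\<bar>)) \<le> convex_envelope (sparse_objective \<gamma> k) u"
proof (rule convex_minorant_le_envelope[OF _ quadratic_growth[folded x_def]])
  have norm_sq: "convex_on UNIV (\<lambda>u :: real ^ 'n. (norm (u - x))\<^sup>2)"
  proof (rule convex_onI)
    fix r :: real and a c :: "real ^ 'n"
    assume r: "0 < r" "r < 1"
    have "(1 - r) * (norm (a - x))\<^sup>2 + r * (norm (c - x))\<^sup>2
        - (norm ((1 - r) *\<^sub>R a + r *\<^sub>R c - x))\<^sup>2 = r * (1 - r) * (norm (a - c))\<^sup>2"
      by (simp add: power2_norm_eq_inner inner_simps inner_commute algebra_simps)
    moreover have "0 \<le> r * (1 - r) * (norm (a - c))\<^sup>2"
      using r by simp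
    ultimately show "(norm ((1 - r) *\<^sub>R a + r *\<^sub>R c - x))\<^sup>2
        \<le> (1 - r) * (norm (a - x))\<^sup>2 + r * (norm (c - x))\<^sup>2"
      by linarith
  qed simp
  have abs_coord: "convex_on UNIV (\<lambda>u :: real ^ 'n. \<bar>u $ i\<bar>)" for i
  proof (rule convex_onI)
    fix r :: real and a c :: "real ^ 'n"
    assume r: "0 < r" "r < 1"
    have "\<bar>((1 - r) *\<^sub>R a + r *\<^sub>R c) $ i\<bar> \<le> \<bar>(1 - r) * a $ i\<bar> + \<bar>r * c $ i\<bar>"
      by (simp add: abs_triangle_ineq)
    then show "\<bar>((1 - r) *\<^sub>R a + r *\<^sub>R c) $ i\<bar> \<le> (1 - r) * \<bar>a $ i\<bar> + r * \<bar>c $ i\<bar>"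
      using r by (simp add: abs_mult)
  qed simp
  have abs_sum: "convex_on UNIV (\<lambda>u :: real ^ 'n. \<Sum>i\<in>-S. \<bar>u $ i\<bar>)"
  proof -
    have "convex_on UNIV (\<lambda>u :: real ^ 'n. \<Sum>i\<in>F. \<bar>u $ i\<bar>)" if "finite F" for F
      using that
    proof induction
      case empty
      show ?case by (simp add: convex_on_const)
    next
      case (insert i F)
      then show ?case
        using convex_on_add[OF abs_coord[of i] insert.IH] by simp
    qed
    then show ?thesis by simp
  qed
  have "convex_on UNIV (\<lambda>u. ((\<Sum>i\<le>k. \<gamma> i) + (norm x)\<^sup>2 - 2 * (z \<bullet> x)) + (2 *\<^sub>R z) \<bullet> u)"
    by (rule convex_on_affine)
  then have aff: "convex_on UNIV (\<lambda>u. (\<Sum>i\<le>k. \<gamma> i) + (norm x)\<^sup>2 + 2 * (z \<bullet> (u - x)))"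
    by (simp add: inner_diff_right algebra_simps)
  show "convex_on UNIV (\<lambda>u. (\<Sum>i\<le>k. \<gamma> i) + (norm x)\<^sup>2 + 2 * (z \<bullet> (u - x))
      + \<delta> * (norm (u - x))\<^sup>2 + slope * (\<Sum>i\<in>-S. \<bar>u $ i\<bar>))"
    using \<delta> slope_pos by (intro convex_on_add[OF convex_on_add[OF aff]] convex_on_cmul norm_sq abs_sum) auto
qed

section \<open>Minimality and uniqueness\<close>

text \<open>
  Compared with the monotonicity inequality \<open>0 \<le> (w - z) \<bullet> (y - x)\<close> of a
  subdifferential, a definite amount \<open>\<delta> * (norm (y - x))\<^sup>2\<close> is gained.  Here the growth
  estimate at \<open>x\<close> alone would give half of it; the optimality of \<open>T\<close> for \<open>w\<close>
  supplies the rest.  If \<open>T\<close> is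
  smaller than \<open>S\<close>, entries of \<open>w\<close> off \<open>T\<close> are below the threshold, while those of \<open>z\<close> on
  \<open>S\<close> are well above it.  A lost index matched with a gained one is handled by the
  exchange property of \<open>T\<close> and the gap of \<open>z\<close>.
\<close>

lemma optimal_supports_strongly_monotone:
  fixes w :: "real ^ 'n" and T :: "'n set"
  defines "x \<equiv> restrict_support S z" and "y \<equiv> restrict_support T w"
  assumes T: "optimal_support \<gamma> k w T" and "y \<noteq> x"
  shows "\<delta> * (norm (y - x))\<^sup>2 < (w - z) \<bullet> (y - x)"
proof -
  have card_T: "card T \<le> k"
    using T by (simp add: optimal_support_def)
  define h where "h i = (w $ i - z $ i) * (y $ i - x $ i) - \<delta> * (y $ i - x $ i)\<^sup>2" for i
  have sum_h: "sum h UNIV = (w - z) \<bullet> (y - x) - \<delta> * (norm (y - x))\<^sup>2"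
    unfolding h_def norm_square_coordinates inner_coordinates
    by (simp add: sum_subtractf sum_distrib_left)
  have common: "h i = (1 - \<delta>) * (y $ i - x $ i)\<^sup>2" if "i \<in> S \<inter> T" for i
    using that by (simp add: h_def x_def y_def power2_eq_square algebra_simps)
  have "0 < sum h UNIV"
  proof (cases "S - T = {}")
    case True
    then have "S = T"
      using card_T card_S by (metis Diff_eq_empty_iff card_seteq finite_class.finite_UNIV finite_subset top_greatest)
    then have "sum h UNIV = (1 - \<delta>) * (norm (y - x))\<^sup>2"
      unfolding norm_square_coordinates sum_distrib_left
      by (intro sum.cong) (auto simp: h_def x_def y_def power2_eq_square algebra_simps)
    then show ?thesis
      using \<delta> \<open>y \<noteq> x\<close> by simp
  next
    case False
    have "sum h UNIV = sum h (S \<inter> T) + (sum h (S - T) + sum h (T - S))"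
      by (rule sum_UNIV_split_two_sets) (auto simp: h_def x_def y_def)
    moreover have "0 \<le> sum h (S \<inter> T)"
      using \<delta> common by (intro sum_nonneg) simp
    moreover have "0 < sum h (S - T) + sum h (T - S)"
    proof (rule sum_pos_by_pairing)
      have card_S_split: "card S = card (S \<inter> T) + card (S - T)"
        by (rule card_Int_Diff) simp
      have card_T_split: "card T = card (S \<inter> T) + card (T - S)"
        by (subst card_Int_Diff[of T S]) (simp_all add: Int_commute)
      show "card (T - S) \<le> card (S - T)"
        using card_S_split card_T_split card_T card_S by simp
      show "0 < h i" if lt: "card (T - S) < card (S - T)" and i: "i \<in> S - T" for i
      proof -
        have less: "card T < k"
          using lt card_S_split card_T_split card_S by simp
        then have "(w $ i)\<^sup>2 \<le> \<gamma> k"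
          using optimal_support_extension[OF T _ less, of i] \<gamma>_le[of "Suc (card T)"] i by simp
        then have "\<bar>w $ i\<bar> \<le> sqrt (\<gamma> k)"
          by (simp add: real_le_rsqrt)
        also have "\<dots> < (1 - \<delta>) * s" by (rule threshold)
        also have "\<dots> \<le> (1 - \<delta>) * \<bar>z $ i\<bar>"
          using large[of i] i \<delta> by (intro mult_left_mono) auto
        finally have "\<bar>w $ i\<bar> * \<bar>z $ i\<bar> < (1 - \<delta>) * \<bar>z $ i\<bar> * \<bar>z $ i\<bar>"
          using large[of i] i s_pos by (intro mult_strict_right_mono) auto
        moreover have "w $ i * z $ i \<le> \<bar>w $ i\<bar> * \<bar>z $ i\<bar>"
          by (metis abs_ge_self abs_mult)
        moreover have "h i = (1 - \<delta>) * \<bar>z $ i\<bar> * \<bar>z $ i\<bar> - w $ i * z $ i"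
          using i by (simp add: h_def x_def y_def power2_eq_square algebra_simps)
        ultimately show ?thesis by linarith
      qed
      show "0 < h i + h l" if i: "i \<in> S - T" and l: "l \<in> T - S" for i l
      proof -
        define a c where "a = \<bar>z $ i\<bar>" and "c = \<bar>w $ l\<bar>"
        have a: "s \<le> a" "0 < a"
          using large[of i] i s_pos by (auto simp: a_def)
        have "\<bar>w $ i\<bar> \<le> c"
          using optimal_support_exchange[OF T] i l by (simp add: c_def)
        then have "\<bar>w $ i\<bar> * a \<le> c * a"
          using a by (intro mult_right_mono) auto
        then have "w $ i * z $ i \<le> c * a"
          unfolding a_def by (metis abs_ge_self abs_mult order_trans)
        moreover have "h i = (1 - \<delta>) * a\<^sup>2 - w $ i * z $ i"
          using i by (simp add: h_def x_def y_def a_def power2_eq_square algebra_simps)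
        ultimately have hi: "(1 - \<delta>) * a\<^sup>2 - c * a \<le> h i" by simp
        define gap where "gap = (1 - 2 * \<delta>) * a - \<bar>z $ l\<bar>"
        have "0 < gap"
        proof -
          have "\<bar>z $ l\<bar> < (1 - 2 * \<delta>) * s"
            using small[of l] l t by simp
          also have "\<dots> \<le> (1 - 2 * \<delta>) * a"
            using a \<delta> by (intro mult_left_mono) auto
          finally show ?thesis by (simp add: gap_def)
        qed
        have "z $ l * w $ l \<le> \<bar>z $ l\<bar> * c"
          unfolding c_def by (metis abs_ge_self abs_mult)
        moreover have "h l = (1 - \<delta>) * c\<^sup>2 - z $ l * w $ l"
          using l by (simp add: h_def x_def y_def c_def power2_eq_square algebra_simps)
        ultimately have hl: "(1 - \<delta>) * c\<^sup>2 - \<bar>z $ l\<bar> * c \<le> h l" by simp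
        have "0 < (1 - \<delta>) * (a - c)\<^sup>2 + gap * c"
        proof (cases "c = 0")
          case True
          then show ?thesis using a \<delta> by simp
        next
          case False
          then have "0 < gap * c"
            using \<open>0 < gap\<close> by (simp add: c_def)
          then show ?thesis
            using \<delta> by (intro add_nonneg_pos) auto
        qed
        also have "\<dots> = ((1 - \<delta>) * a\<^sup>2 - c * a) + ((1 - \<delta>) * c\<^sup>2 - \<bar>z $ l\<bar> * c)"
          by (simp add: gap_def power2_eq_square algebra_simps)
        finally show ?thesis
          using hi hl by linarith
      qed
    qed (use False in auto)
    ultimately show ?thesis by simp
  qed
  then show ?thesis
    using sum_h by simp
qed

lemma envelope_at_support:
  defines "x \<equiv> restrict_support S z"
  shows "convex_envelope (sparse_objective \<gamma> k) x = ereal ((\<Sum>i\<le>k. \<gamma> i) + (norm x)\<^sup>2)"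
proof (rule antisym)
  have "convex_envelope (sparse_objective \<gamma> k) x \<le> sparse_objective \<gamma> k x"
    by (rule le_funD[OF convex_envelope_le])
  then show "convex_envelope (sparse_objective \<gamma> k) x \<le> ereal ((\<Sum>i\<le>k. \<gamma> i) + (norm x)\<^sup>2)"
    by (simp add: sparse_objective_def x_def nnz_restrict)
  have "(\<Sum>i\<in>-S. \<bar>x $ i\<bar>) = 0"
    by (rule sum.neutral) (simp add: x_def)
  then show "ereal ((\<Sum>i\<le>k. \<gamma> i) + (norm x)\<^sup>2) \<le> convex_envelope (sparse_objective \<gamma> k) x"
    using envelope_quadratic_growth[of x, folded x_def] by simp
qed

text \<open>
  Split a displacement \<open>d\<close> into its parts \<open>d1\<close> on \<open>S\<close> and \<open>d2\<close> off \<open>S\<close>.  The quadratic growth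
  and the restricted isometry compensate the concave part along \<open>d1\<close>.  What involves
  \<open>d2\<close> is at most \<open>3 * norm d * norm d2\<close>, which the linear growth absorbs near \<open>x\<close>.
\<close>

lemma local_minimizer_of_regularization:
  fixes A :: "real ^ 'n ^ 'm"
  defines "x \<equiv> restrict_support S z"
  assumes stat: "z = (mat 1 - transpose A ** A) *v x + transpose A *v b"
    and RIP: "\<And>v. nnz v \<le> k \<Longrightarrow> (1 - \<delta>) * (norm v)\<^sup>2 \<le> (norm (A *v v))\<^sup>2"
    and nonexpansive: "\<And>v. norm (A *v v) \<le> norm v"
  shows "local_minimizer (\<lambda>u. convex_envelope (sparse_objective \<gamma> k) u - ereal ((norm u)\<^sup>2)
    + ereal ((norm (A *v u - b))\<^sup>2)) x" (is "local_minimizer ?K x")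
proof -
  have "?K x \<le> ?K u" if u: "dist x u < slope / 3" for u
  proof -
    define d where "d = u - x"
    define d1 d2 where "d1 = restrict_support S d" and "d2 = restrict_support (- S) d"
    have d: "d = d1 + d2"
      by (simp add: d1_def d2_def restrict_support_add)
    have orth: "d1 \<bullet> d2 = 0"
      by (simp add: d1_def d2_def restrict_support_orthogonal)
    have pyth: "(norm d)\<^sup>2 = (norm d1)\<^sup>2 + (norm d2)\<^sup>2"
      unfolding power2_norm_eq_inner d using orth by (simp add: inner_simps inner_commute)
    have le: "norm d1 \<le> norm d" "norm d2 \<le> norm d"
      by (rule power2_le_imp_le; simp add: pyth)+
    have "nnz d1 \<le> k"
      unfolding nnz_def card_S[symmetric] by (rule card_mono) (auto simp: d1_def)
    then have A1: "(1 - \<delta>) * (norm d1)\<^sup>2 \<le> (norm (A *v d1))\<^sup>2"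
      by (rule RIP)
    have "\<bar>(A *v d1) \<bullet> (A *v d2)\<bar> \<le> norm (A *v d1) * norm (A *v d2)"
      by (rule Cauchy_Schwarz_ineq2)
    also have "\<dots> \<le> norm d * norm d2"
      using nonexpansive le by (intro mult_mono order_trans[OF nonexpansive]) auto
    finally have cross: "- (norm d * norm d2) \<le> (A *v d1) \<bullet> (A *v d2)"
      by linarith
    have "(norm (A *v d))\<^sup>2 = (norm (A *v d1))\<^sup>2 + 2 * ((A *v d1) \<bullet> (A *v d2)) + (norm (A *v d2))\<^sup>2"
      unfolding power2_norm_eq_inner d by (simp add: matrix_vector_right_distrib inner_simps inner_commute)
    then have "(1 - \<delta>) * (norm d1)\<^sup>2 - 2 * (norm d * norm d2) \<le> (norm (A *v d))\<^sup>2"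
      using A1 cross zero_le_power2[of "norm (A *v d2)"] by linarith
    moreover have "(1 - \<delta>) * (norm d2)\<^sup>2 \<le> norm d * norm d2"
    proof -
      have "(1 - \<delta>) * (norm d2)\<^sup>2 \<le> 1 * (norm d2 * norm d2)"
        using \<delta> unfolding power2_eq_square by (intro mult_right_mono) auto
      also have "\<dots> \<le> norm d * norm d2"
        using le by (simp add: mult_right_mono)
      finally show ?thesis .
    qed
    moreover have "3 * (norm d * norm d2) \<le> slope * (\<Sum>i\<in>-S. \<bar>u $ i\<bar>)"
    proof -
      have "3 * norm d \<le> slope"
        using u by (simp add: d_def dist_norm norm_minus_commute)
      moreover have "norm d2 \<le> (\<Sum>i\<in>-S. \<bar>u $ i\<bar>)"
        using norm_restrict_le_l1[of "-S" d] by (simp add: d2_def d_def x_def)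
      ultimately have "(3 * norm d) * norm d2 \<le> slope * (\<Sum>i\<in>-S. \<bar>u $ i\<bar>)"
        using slope_pos by (intro mult_mono) auto
      then show ?thesis by simp
    qed
    ultimately have key: "0 \<le> \<delta> * (norm d)\<^sup>2 + slope * (\<Sum>i\<in>-S. \<bar>u $ i\<bar>)
        + (norm (A *v d))\<^sup>2 - (norm d)\<^sup>2"
      unfolding pyth by (simp add: algebra_simps)
    have "?K x = ereal ((\<Sum>i\<le>k. \<gamma> i) + (norm (A *v x - b))\<^sup>2)"
      using envelope_at_support by (simp add: x_def)
    also have "\<dots> \<le> ereal ((\<Sum>i\<le>k. \<gamma> i) + (norm x)\<^sup>2 + 2 * (z \<bullet> (u - x)) + \<delta> * (norm (u - x))\<^sup>2
        + slope * (\<Sum>i\<in>-S. \<bar>u $ i\<bar>)) - ereal ((norm u)\<^sup>2) + ereal ((norm (A *v u - b))\<^sup>2)"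
      using least_squares_expansion[OF stat, of u] key by (simp add: d_def)
    also have "\<dots> \<le> ?K u"
      using envelope_quadratic_growth[of u] by (intro add_right_mono ereal_minus_mono) (auto simp: x_def)
    finally show ?thesis .
  qed
  then show ?thesis
    using slope_pos envelope_at_support
    by (auto simp: local_minimizer_def x_def intro!: exI[of _ "slope / 3"])
qed

text \<open>
  A displacement between two \<open>k\<close>-sparse vectors is \<open>2 * k\<close>-sparse, so the quadratic growth
  compensates the concave part without any restriction to a neighbourhood.
\<close>

lemma sparse_global_minimizer:
  fixes A :: "real ^ 'n ^ 'm"
  defines "x \<equiv> restrict_support S z"
  assumes stat: "z = (mat 1 - transpose A ** A) *v x + transpose A *v b"
    and RIP: "\<And>v. nnz v \<le> 2 * k \<Longrightarrow> (1 - \<delta>) * (norm v)\<^sup>2 \<le> (norm (A *v v))\<^sup>2"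
    and u: "nnz u \<le> k"
  shows "(\<Sum>i\<le>k. \<gamma> i) + (norm (A *v x - b))\<^sup>2 \<le> (\<Sum>i\<le>nnz u. \<gamma> i) + (norm (A *v u - b))\<^sup>2"
proof -
  have "nnz (u - x) \<le> 2 * k"
    using nnz_diff_le[of u x] u nnz_restrict by (simp add: x_def)
  then have "(1 - \<delta>) * (norm (u - x))\<^sup>2 \<le> (norm (A *v (u - x)))\<^sup>2"
    by (rule RIP)
  moreover have "(\<Sum>i\<le>k. \<gamma> i) + (norm x)\<^sup>2 + 2 * (z \<bullet> (u - x)) + \<delta> * (norm (u - x))\<^sup>2
      + slope * (\<Sum>i\<in>-S. \<bar>u $ i\<bar>) \<le> (\<Sum>i\<le>nnz u. \<gamma> i) + (norm u)\<^sup>2"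
    using quadratic_growth[of u] u by (simp add: sparse_objective_def x_def)
  moreover have "0 \<le> slope * (\<Sum>i\<in>-S. \<bar>u $ i\<bar>)"
    using slope_pos by (simp add: sum_nonneg)
  ultimately show ?thesis
    using least_squares_expansion[OF stat, of u] by (simp add: left_diff_distrib)
qed

text \<open>
  Another local minimizer \<open>y\<close> is stationary, with its own \<open>w\<close> in place of \<open>z\<close>.  Strict
  concavity identifies it with the restriction of \<open>w\<close> to an optimal support, which
  makes \<open>y\<close> \<open>k\<close>-sparse.  Then \<open>(w - z) \<bullet> (y - x)\<close> is bounded above by the restricted
  isometry and below by strong monotonicity, and the bounds contradict each other.
\<close>

lemma local_minimizer_unique:
  fixes A :: "real ^ 'n ^ 'm"
  defines "x \<equiv> restrict_support S z"
  assumes stat: "z = (mat 1 - transpose A ** A) *v x + transpose A *v b"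
    and RIP: "\<And>v. nnz v \<le> 2 * k \<Longrightarrow> (1 - \<delta>) * (norm v)\<^sup>2 \<le> (norm (A *v v))\<^sup>2"
    and contraction: "\<And>v. v \<noteq> 0 \<Longrightarrow> norm (A *v v) < norm v"
    and loc: "local_minimizer (\<lambda>u. convex_envelope (sparse_objective \<gamma> k) u - ereal ((norm u)\<^sup>2)
      + ereal ((norm (A *v u - b))\<^sup>2)) y"
  shows "y = x"
proof (rule ccontr)
  assume "y \<noteq> x"
  define w where "w = (mat 1 - transpose A ** A) *v y + transpose A *v b"
  have stationary: "2 *\<^sub>R w \<in> subdifferential (convex_envelope (sparse_objective \<gamma> k)) y"
    using econvex_convex_envelope loc w_def by (rule local_minimizer_imp_stationary)
  obtain T where T: "optimal_support \<gamma> k w T"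
    using stationary_sparse_objective(1)[OF \<gamma>_nonneg stationary] by blast
  have "restrict_support T w = y"
    using econvex_convex_envelope loc w_def contraction
      stationary_sparse_objective(3)[OF \<gamma>_nonneg stationary T]
    by (rule local_minimizer_tangent_unique)
  then have y: "y = restrict_support T w" ..
  have "nnz y \<le> card T"
    unfolding nnz_def y by (rule card_mono) auto
  then have "nnz (y - x) \<le> 2 * k"
    using T nnz_diff_le[of y x] nnz_restrict by (simp add: optimal_support_def x_def)
  then have "(1 - \<delta>) * (norm (y - x))\<^sup>2 \<le> (norm (A *v (y - x)))\<^sup>2"
    by (rule RIP)
  moreover have "(w - z) \<bullet> (y - x) = (norm (y - x))\<^sup>2 - (norm (A *v (y - x)))\<^sup>2"
  proof -
    have "norm (A *v (x - y)) = norm (A *v (y - x))"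
      by (simp add: matrix_vector_mult_diff_distrib norm_minus_commute)
    then show ?thesis
      using least_squares_expansion[OF stat, of y] least_squares_expansion[OF w_def, of x]
      by (simp add: inner_diff_left inner_diff_right norm_minus_commute)
  qed
  moreover have "\<delta> * (norm (y - x))\<^sup>2 < (w - z) \<bullet> (y - x)"
    using optimal_supports_strongly_monotone[OF T] \<open>y \<noteq> x\<close> by (simp add: x_def y)
  ultimately show False
    by (simp add: left_diff_distrib)
qed

end

section \<open>Stationary points under the gap conditions\<close>

theorem corollary3p4:
  fixes A :: "real ^ 'n ^ 'm" and b :: "real ^ 'm"
    and g :: "nat \<Rightarrow> ereal" and x z :: "real ^ 'n"
    and k :: nat and \<delta> :: real
  assumes g0: "g 0 = 0"
    and g_mono: "\<And>i. i < CARD('n) \<Longrightarrow> g i \<le> g (Suc i)"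
    and z_def: "z = (mat 1 - transpose A ** A) *v x + transpose A *v b"
    and stationary: "2 *\<^sub>R z \<in> subdifferential (convex_envelope (f_g g)) x"
    and card_x: "nnz x = k"
    and RIP: "\<And>v :: real ^ 'n. nnz v \<le> 2 * k \<Longrightarrow>
        (1 - \<delta>) * (norm v)\<^sup>2 \<le> (norm (A *v v))\<^sup>2 \<and>
        (norm (A *v v))\<^sup>2 \<le> (1 + \<delta>) * (norm v)\<^sup>2"
    and x_gap: "\<And>i. i \<in> {1..CARD('n)} \<Longrightarrow>
        sorted_abs x i \<notin> {0<..<esqrt (g i)}"
    and z_gap: "\<And>i. i \<in> {1..CARD('n)} \<Longrightarrow>
        sorted_abs z i \<notin>
          {ereal (1 - \<delta>) * esqrt (g k) .. esqrt (g k) / ereal (1 - \<delta>)}"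
    and z_drop: "sorted_abs z (k + 1) < ereal (1 - 2 * \<delta>) * sorted_abs z k"
    and A_norm: "onorm (\<lambda>v. A *v v) < 1"
    and g_infinite: "\<And>i. k < i \<Longrightarrow> i \<le> CARD('n) \<Longrightarrow> g i = \<infinity>"
  shows "unique_local_minimizer (\<lambda>y. R_g g y + ereal ((norm (A *v y - b))\<^sup>2)) x \<and>
         global_minimizer (\<lambda>y. G_g g (nnz y) + ereal ((norm (A *v y - b))\<^sup>2)) x"
proof (cases "k = 0")
  case True
  \<comment> \<open>Here \<open>f\<close> is \<open>0\<close> at the origin and infinite elsewhere, and is its own envelope.\<close>
  define \<gamma> where "\<gamma> i = (0 :: real)" for i :: nat
  have "x = 0"
    using card_x True nnz_eq_0[of x] by simp
  have G: "G_g g j = (if j \<le> 0 then ereal (\<Sum>i\<le>j. \<gamma> i) else \<infinity>)" if "j \<le> CARD('n)" for j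
    using g0 g_infinite True that by (intro G_g_truncated[of 0 g \<gamma> "CARD('n)"]) (auto simp: \<gamma>_def zero_ereal_def)
  have f: "f_g g u = sparse_objective \<gamma> 0 u" for u :: "real ^ 'n"
    using G[OF nnz_le_dimension[of u]] by (simp add: f_g_def sparse_objective_def)
  have "sparse_objective \<gamma> 0 \<le> convex_envelope (sparse_objective \<gamma> 0 :: real ^ 'n \<Rightarrow> ereal)"
    using econvex_sparse_objective_0 by (rule convex_envelope_greatest) simp
  then have env: "convex_envelope (f_g g) = (sparse_objective \<gamma> 0 :: real ^ 'n \<Rightarrow> ereal)"
    unfolding f[abs_def] by (intro antisym convex_envelope_le)
  have R: "R_g g u + ereal ((norm (A *v u - b))\<^sup>2) = (if u = 0 then ereal ((norm b)\<^sup>2) else \<infinity>)" for u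
    by (simp add: R_g_def env sparse_objective_def nnz_eq_0 \<gamma>_def)
  have F: "G_g g (nnz u) + ereal ((norm (A *v u - b))\<^sup>2) = (if u = 0 then ereal ((norm b)\<^sup>2) else \<infinity>)"
    for u :: "real ^ 'n"
    using G[OF nnz_le_dimension[of u]] by (simp add: nnz_eq_0 \<gamma>_def)
  show ?thesis
    unfolding R F \<open>x = 0\<close>
    by (auto simp: unique_local_minimizer_def local_minimizer_def global_minimizer_def
        intro: exI[of _ 1] split: if_splits)
next
  case False
  then have "1 \<le> k" by simp
  have "k \<le> CARD('n)"
    using nnz_le_dimension[of x] card_x by simp
  define \<gamma> where "\<gamma> i = real_of_ereal (g i)" for i
  have g_le: "g i \<le> g j" if "i \<le> j" "j \<le> CARD('n)" for i j
    using that
  proof (induction rule: dec_induct)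
    case (step j)
    then show ?case
      using g_mono[of j] by (simp add: order_trans)
  qed simp
  \<comment> \<open>The gap condition on \<open>x\<close> at index \<open>k\<close> keeps its nonzero entries from lying below \<open>sqrt (g k)\<close>, so \<open>g k\<close> is finite.\<close>
  obtain X sx tx where X: "card X = k" "sorted_abs x k = ereal sx" "tx \<le> sx"
    "\<And>i. i \<in> X \<Longrightarrow> sx \<le> \<bar>x $ i\<bar>" "\<And>i. i \<notin> X \<Longrightarrow> \<bar>x $ i\<bar> \<le> tx" "0 \<le> tx" "\<exists>i\<in>X. \<bar>x $ i\<bar> = sx"
    using sorted_abs_split[OF \<open>1 \<le> k\<close> \<open>k \<le> CARD('n)\<close>, of x] by metis
  have "0 < sx"
  proof (rule ccontr)
    assume "\<not> 0 < sx"
    then have "sx = 0" "tx = 0" using X(3,6) by auto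
    then obtain i where i: "i \<in> X" "x $ i = 0" using X(7) by auto
    have "{j. x $ j \<noteq> 0} \<subseteq> X - {i}"
      using X(5) i \<open>tx = 0\<close> by force
    then have "nnz x \<le> card (X - {i})"
      unfolding nnz_def by (intro card_mono) auto
    then show False
      using i X(1) card_x \<open>1 \<le> k\<close> by simp
  qed
  have not_in: "ereal sx \<notin> {0<..<esqrt (g k)}"
    using x_gap[of k] X(2) \<open>1 \<le> k\<close> \<open>k \<le> CARD('n)\<close> by auto
  have "0 \<le> g k"
    using g_le[of 0 k] g0 \<open>k \<le> CARD('n)\<close> by simp
  moreover have "g k \<noteq> \<infinity>"
    using not_in \<open>0 < sx\<close> by (auto simp: esqrt_def)
  ultimately have gk: "g k = ereal (\<gamma> k)"
    by (cases "g k") (auto simp: \<gamma>_def)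
  have g: "g i = ereal (\<gamma> i)" and \<gamma>_nonneg: "0 \<le> \<gamma> i" and \<gamma>_le: "\<gamma> i \<le> \<gamma> k" if "i \<le> k" for i
  proof -
    have "0 \<le> g i" "g i \<le> g k"
      using g_le[of 0 i] g_le[of i k] g0 that \<open>k \<le> CARD('n)\<close> by simp_all
    then obtain r where "g i = ereal r" "0 \<le> r" "r \<le> \<gamma> k"
      unfolding gk by (cases "g i") auto
    then show "g i = ereal (\<gamma> i)" "0 \<le> \<gamma> i" "\<gamma> i \<le> \<gamma> k"
      by (simp_all add: \<gamma>_def)
  qed
  have sqrt_gk: "esqrt (g k) = ereal (sqrt (\<gamma> k))"
    by (simp add: gk esqrt_def)
  have "sqrt (\<gamma> k) \<le> sx"
    using not_in \<open>0 < sx\<close> sqrt_gk by auto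
  have G: "G_g g j = (if j \<le> k then ereal (\<Sum>i\<le>j. \<gamma> i) else \<infinity>)" if "j \<le> CARD('n)" for j
    using g g_infinite that by (rule G_g_truncated)
  have f: "f_g g u = sparse_objective \<gamma> k u" for u :: "real ^ 'n"
    using G[OF nnz_le_dimension[of u]] by (simp add: f_g_def sparse_objective_def)
  then have f_eq: "f_g g = (sparse_objective \<gamma> k :: real ^ 'n \<Rightarrow> ereal)"
    by (rule ext)
  have stat: "2 *\<^sub>R z \<in> subdifferential (convex_envelope (sparse_objective \<gamma> k)) x"
    using stationary by (simp add: f_eq)
  note hull = stationary_sparse_objective[OF \<gamma>_nonneg stat]

  have contraction: "norm (A *v v) < norm v" if "v \<noteq> 0" for v
  proof -
    have "norm (A *v v) \<le> onorm (\<lambda>v. A *v v) * norm v"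
      by (rule onorm[OF matrix_vector_mul_bounded_linear])
    also have "\<dots> < 1 * norm v"
      using A_norm that by (intro mult_strict_right_mono) auto
    finally show ?thesis by simp
  qed
  have nonexpansive: "norm (A *v v) \<le> norm v" for v
    using contraction[of v] by (cases "v = 0") auto

  obtain S s t where S: "card S = k" "sorted_abs z k = ereal s" "sorted_abs z (k + 1) = ereal t"
    "0 \<le> t" "t \<le> s" "\<And>i. i \<in> S \<Longrightarrow> s \<le> \<bar>z $ i\<bar>" "\<And>i. i \<notin> S \<Longrightarrow> \<bar>z $ i\<bar> \<le> t"
    "\<exists>i\<in>S. \<bar>z $ i\<bar> = s"
    using sorted_abs_split[OF \<open>1 \<le> k\<close> \<open>k \<le> CARD('n)\<close>, of z] by metis
  have drop: "t < (1 - 2 * \<delta>) * s"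
    using z_drop S(2,3) by simp
  have "\<delta> < 1 / 2"
  proof -
    have "0 < (1 - 2 * \<delta>) * s" "0 \<le> s"
      using drop S(4,5) by linarith+
    then show ?thesis
      by (simp add: zero_less_mult_iff)
  qed
  \<comment> \<open>A coordinate vector shrinks strictly under \<open>A\<close>, but keeps at least the fraction \<open>1 - \<delta>\<close> of its squared norm.\<close>
  have "0 < \<delta>"
  proof -
    define v :: "real ^ 'n" where "v = axis undefined 1"
    have "nnz v \<le> 2 * k"
      using \<open>1 \<le> k\<close> by (simp add: v_def nnz_def axis_def)
    moreover have "norm v = 1"
      by (simp add: v_def)
    moreover have "(norm (A *v v))\<^sup>2 < 1"
    proof -
      have "norm (A *v v) < 1"
        using contraction[of v] \<open>norm v = 1\<close> by (cases "v = 0") auto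
      then show ?thesis
        by (simp add: power_less_one_iff abs_square_less_1)
    qed
    ultimately show ?thesis
      using RIP[of v] by simp
  qed

  \<comment> \<open>Points of the hull are dominated by \<open>z\<close> entrywise, so \<open>k\<close> entries of \<open>z\<close> reach the threshold.\<close>
  have "sqrt (\<gamma> k) \<le> s"
  proof (rule ccontr)
    assume less: "\<not> sqrt (\<gamma> k) \<le> s"
    obtain i where i: "i \<in> S" "\<bar>z $ i\<bar> = s" using S(8) by auto
    have xz: "\<bar>x $ j\<bar> \<le> \<bar>z $ j\<bar>" for j
      using hull(2) by (rule hull_restrictions_coordinate_le)
    have "X \<subseteq> S - {i}"
    proof
      fix j assume "j \<in> X"
      then have "s < \<bar>z $ j\<bar>"
        using X(4)[of j] xz[of j] \<open>sqrt (\<gamma> k) \<le> sx\<close> less by linarith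
      then show "j \<in> S - {i}"
        using S(5) S(7)[of j] i(2) by auto
    qed
    then have "card X \<le> card (S - {i})"
      by (intro card_mono) auto
    then show False
      using i(1) X(1) S(1) \<open>1 \<le> k\<close> by simp
  qed
  \<comment> \<open>The forbidden band for the entries of \<open>z\<close> turns this into a definite excess.\<close>
  have threshold: "sqrt (\<gamma> k) < (1 - \<delta>) * s"
  proof -
    have "ereal s \<notin> {ereal ((1 - \<delta>) * sqrt (\<gamma> k)) .. ereal (sqrt (\<gamma> k) / (1 - \<delta>))}"
      using z_gap[of k] \<open>1 \<le> k\<close> \<open>k \<le> CARD('n)\<close> \<open>\<delta> < 1 / 2\<close> by (simp add: S(2) sqrt_gk)
    moreover have "(1 - \<delta>) * sqrt (\<gamma> k) \<le> 1 * sqrt (\<gamma> k)"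
      using \<open>0 < \<delta>\<close> \<gamma>_nonneg[of k] by (intro mult_right_mono) auto
    ultimately have "sqrt (\<gamma> k) / (1 - \<delta>) < s"
      using \<open>sqrt (\<gamma> k) \<le> s\<close> by auto
    then show ?thesis
      using \<open>\<delta> < 1 / 2\<close> by (simp add: pos_divide_less_eq mult.commute)
  qed

  interpret separated_support \<gamma> k z S s t \<delta>
    by unfold_locales
      (use \<gamma>_nonneg \<gamma>_le S \<open>0 < \<delta>\<close> \<open>\<delta> < 1 / 2\<close> drop threshold in auto)

  have x: "x = restrict_support S z"
  proof -
    have "{T. optimal_support \<gamma> k z T} \<subseteq> {S}"
      using unique_optimal_support by auto
    then have "x \<in> convex hull {restrict_support S z}"
      using hull(2) hull_mono[of "(\<lambda>T. restrict_support T z) ` {T. optimal_support \<gamma> k z T}"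
          "{restrict_support S z}" convex] by auto
    then show ?thesis by simp
  qed
  have RIP_lower: "(1 - \<delta>) * (norm v)\<^sup>2 \<le> (norm (A *v v))\<^sup>2" if "nnz v \<le> 2 * k" for v :: "real ^ 'n"
    using RIP[OF that] by simp
  have z_eq: "z = (mat 1 - transpose A ** A) *v restrict_support S z + transpose A *v b"
    using z_def unfolding x .

  let ?K = "\<lambda>u. convex_envelope (sparse_objective \<gamma> k) u - ereal ((norm u)\<^sup>2)
      + ereal ((norm (A *v u - b))\<^sup>2)"
  have "local_minimizer ?K (restrict_support S z)"
    using z_eq RIP_lower nonexpansive by (intro local_minimizer_of_regularization) simp_all
  moreover have "y = restrict_support S z" if "local_minimizer ?K y" for y
    using z_eq RIP_lower contraction that by (rule local_minimizer_unique)
  ultimately have "unique_local_minimizer (\<lambda>y. R_g g y + ereal ((norm (A *v y - b))\<^sup>2)) x"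
    unfolding unique_local_minimizer_def R_g_def f_eq x by (intro conjI allI impI)
  moreover have "global_minimizer (\<lambda>y. G_g g (nnz y) + ereal ((norm (A *v y - b))\<^sup>2)) x"
    unfolding global_minimizer_def
  proof (intro conjI allI)
    have Gx: "G_g g (nnz x) = ereal (\<Sum>i\<le>k. \<gamma> i)"
      using G[OF \<open>k \<le> CARD('n)\<close>] card_x by simp
    then show "\<bar>G_g g (nnz x) + ereal ((norm (A *v x - b))\<^sup>2)\<bar> \<noteq> \<infinity>"
      by simp
    fix u :: "real ^ 'n"
    show "G_g g (nnz x) + ereal ((norm (A *v x - b))\<^sup>2) \<le> G_g g (nnz u) + ereal ((norm (A *v u - b))\<^sup>2)"
    proof (cases "nnz u \<le> k")
      case True
      then show ?thesis
        using sparse_global_minimizer[OF z_eq RIP_lower True] G[OF nnz_le_dimension[of u]]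
        unfolding Gx by (simp flip: x)
    next
      case False
      then show ?thesis
        using G[OF nnz_le_dimension[of u]] by simp
    qed
  qed
  ultimately show ?thesis ..
qed

end
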